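(* Let $f:\mathcal{G}\to\mathbb{R}^+$ and let $\{G_i\}_{i=1}^\infty$ be a sequence of finite graphs such that $\{A(G_i)/f(G_i)\}_{i=1}^\infty$ is an action convergent sequence of $P$-operators. Assume that there exist $p\in[1,\infty)$, $q\in(1,\infty)$ and $c\in\mathbb{R}^+$ such that $\|A(G_i)/f(G_i)\|_{p\to q}\le c$ for every $i$. Then there is a graphop $A$ such that $\lim_{i\to\infty}d_M(A(G_i)/f(G_i),A)=0$.
   Context: $\mathcal{G}$ is the set of isomorphism classes of finite graphs. For a graph $G$ on $[n]$, $A(G)$ is the $P$-operator on $([n],\text{uniform measure})$ given by $(vA(G))(i)=\sum_{(j,i)\in E(G)}v(j)$. A $P$-operator on a probability space $\Omega$ is a linear $A:L^\infty(\Omega)\to L^1(\Omega)$, $v\mapsto vA$, with $\|A\|_{\infty\to1}<\infty$; $\|A\|_{p\to q}=\sup_{v\in L^\infty}\|vA\|_q/\|v\|_p$. With $(f,g)_A=\int(fA)g$, $A$ is self-adjoint if $(v,w)_A=(w,v)_A$ for all $v,w$, positivity-preserving if $v\ge0$ a.e. implies $vA\ge0$ a.e.; a graphop is a self-adjoint positivity-preserving $P$-operator. $\mathcal{S}_k(A)$ is the set of joint distributions of $(v_1,\dots,v_k,v_1A,\dots,v_kA)$ over measurable $v_i:\Omega\to[-1,1]$; $d_M(A,B)=\sum_k2^{-k}d_H(\mathcal{S}_k(A),\mathcal{S}_k(B))$ with $d_H$ the Hausdorff distance induced by the Lévy–Prokhorov metric; action convergence means each $\{\mathcal{S}_k\}$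 is $d_H$-Cauchy. *)

theory Defs
  imports "HOL-Probability.Probability"
begin

definition Linf :: "'a measure \<Rightarrow> ('a \<Rightarrow> real) set" where
  "Linf M = {v. v \<in> borel_measurable M \<and> (\<exists>C. AE x in M. \<bar>v x\<bar> \<le> C)}"

text \<open>A P-operator: linear map from L-infinity to L1 (acting on representatives,
 compatible with a.e. equality), with finite infinity-to-1 norm.\<close>
definition P_operator :: "'a measure \<Rightarrow> (('a \<Rightarrow> real) \<Rightarrow> ('a \<Rightarrow> real)) \<Rightarrow> bool" where
  "P_operator M A \<longleftrightarrow> prob_space M \<and>
     (\<forall>v\<in>Linf M. integrable M (A v)) \<and>
     (\<forall>v\<in>Linf M. \<forall>w\<in>Linf M. (AE x in M. v x = w x) \<longrightarrow> (AE x in M. A v x = A w x)) \<and>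
     (\<forall>v\<in>Linf M. \<forall>w\<in>Linf M. AE x in M. A (\<lambda>y. v y + w y) x = A v x + A w x) \<and>
     (\<forall>v\<in>Linf M. \<forall>c::real. AE x in M. A (\<lambda>y. c * v y) x = c * A v x) \<and>
     (\<exists>C::real. \<forall>v\<in>Linf M. \<forall>B. (AE x in M. \<bar>v x\<bar> \<le> B) \<longrightarrow> (\<integral>x. \<bar>A v x\<bar> \<partial>M) \<le> C * B)"

definition Lp_norm :: "'a measure \<Rightarrow> real \<Rightarrow> ('a \<Rightarrow> real) \<Rightarrow> ennreal" where
  "Lp_norm M p f =
     (let I = (\<integral>\<^sup>+x. ennreal (\<bar>f x\<bar> powr p) \<partial>M)
      in if I = \<infinity> then \<infinity> else ennreal ((enn2real I) powr (1 / p)))"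

definition pq_norm :: "'a measure \<Rightarrow> real \<Rightarrow> real \<Rightarrow> (('a \<Rightarrow> real) \<Rightarrow> ('a \<Rightarrow> real)) \<Rightarrow> ennreal" where
  "pq_norm M p q A =
     (SUP v\<in>{v\<in>Linf M. Lp_norm M p v \<noteq> 0}. Lp_norm M q (A v) / Lp_norm M p v)"

definition self_adjoint_op :: "'a measure \<Rightarrow> (('a \<Rightarrow> real) \<Rightarrow> ('a \<Rightarrow> real)) \<Rightarrow> bool" where
  "self_adjoint_op M A \<longleftrightarrow>
     (\<forall>v\<in>Linf M. \<forall>w\<in>Linf M. (\<integral>x. A v x * w x \<partial>M) = (\<integral>x. A w x * v x \<partial>M))"

definition positivity_preserving :: "'a measure \<Rightarrow> (('a \<Rightarrow> real) \<Rightarrow> ('a \<Rightarrow> real)) \<Rightarrow> bool" where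
  "positivity_preserving M A \<longleftrightarrow>
     (\<forall>v\<in>Linf M. (AE x in M. v x \<ge> 0) \<longrightarrow> (AE x in M. A v x \<ge> 0))"

definition graphop :: "'a measure \<Rightarrow> (('a \<Rightarrow> real) \<Rightarrow> ('a \<Rightarrow> real)) \<Rightarrow> bool" where
  "graphop M A \<longleftrightarrow> P_operator M A \<and> self_adjoint_op M A \<and> positivity_preserving M A"

text \<open>R^n is modelled as extensional functions on {..<n} with the product Borel
 structure and the Euclidean distance.\<close>
definition Rspace :: "nat \<Rightarrow> (nat \<Rightarrow> real) measure" where
  "Rspace n = PiM {..<n} (\<lambda>_. borel)"

definition dist_fin :: "nat \<Rightarrow> (nat \<Rightarrow> real) \<Rightarrow> (nat \<Rightarrow> real) \<Rightarrow> real" where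
  "dist_fin n x y = sqrt (\<Sum>i<n. (x i - y i)\<^sup>2)"

definition nbhd :: "nat \<Rightarrow> (nat \<Rightarrow> real) set \<Rightarrow> real \<Rightarrow> (nat \<Rightarrow> real) set" where
  "nbhd n U e = {y\<in>space (Rspace n). \<exists>x\<in>U. dist_fin n x y < e}"

definition LP_dist :: "nat \<Rightarrow> (nat \<Rightarrow> real) measure \<Rightarrow> (nat \<Rightarrow> real) measure \<Rightarrow> real" where
  "LP_dist n \<mu> \<nu> = Inf {e. e > 0 \<and> (\<forall>U\<in>sets (Rspace n).
       measure \<mu> U \<le> measure \<nu> (nbhd n U e) + e \<and> measure \<nu> U \<le> measure \<mu> (nbhd n U e) + e)}"

definition hausdorff_LP :: "nat \<Rightarrow> (nat \<Rightarrow> real) measure set \<Rightarrow> (nat \<Rightarrow> real) measure set \<Rightarrow> real" where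
  "hausdorff_LP n X Y = max (SUP \<mu>\<in>X. INF \<nu>\<in>Y. LP_dist n \<mu> \<nu>) (SUP \<nu>\<in>Y. INF \<mu>\<in>X. LP_dist n \<mu> \<nu>)"

definition S_k :: "'a measure \<Rightarrow> (('a \<Rightarrow> real) \<Rightarrow> ('a \<Rightarrow> real)) \<Rightarrow> nat \<Rightarrow> (nat \<Rightarrow> real) measure set" where
  "S_k M A k = {distr M (Rspace (2 * k))
        (\<lambda>x. \<lambda>i\<in>{..<2 * k}. if i < k then v i x else A (v (i - k)) x) | v.
        \<forall>i<k. v i \<in> borel_measurable M \<and> (\<forall>x\<in>space M. v i x \<in> {-1..1})}"

definition d_M :: "'a measure \<Rightarrow> (('a \<Rightarrow> real) \<Rightarrow> ('a \<Rightarrow> real)) \<Rightarrow>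
                   'b measure \<Rightarrow> (('b \<Rightarrow> real) \<Rightarrow> ('b \<Rightarrow> real)) \<Rightarrow> real" where
  "d_M M A N B = (\<Sum>k. (1/2) ^ Suc k * hausdorff_LP (2 * Suc k) (S_k M A (Suc k)) (S_k N B (Suc k)))"

definition action_convergent :: "(nat \<Rightarrow> 'a measure) \<Rightarrow> (nat \<Rightarrow> (('a \<Rightarrow> real) \<Rightarrow> ('a \<Rightarrow> real))) \<Rightarrow> bool" where
  "action_convergent M A \<longleftrightarrow> (\<forall>n. P_operator (M n) (A n)) \<and>
     (\<forall>k\<ge>1. \<forall>e>0. \<exists>N. \<forall>m\<ge>N. \<forall>n\<ge>N. hausdorff_LP (2 * k) (S_k (M m) (A m) k) (S_k (M n) (A n) k) < e)"

text \<open>A finite simple graph on vertex set [n] = {0..<n} (n \<ge> 1), edges as a symmetric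
 irreflexive relation.\<close>
definition finite_graph :: "nat \<times> (nat \<times> nat) set \<Rightarrow> bool" where
  "finite_graph G \<longleftrightarrow> 0 < fst G \<and> snd G \<subseteq> {..<fst G} \<times> {..<fst G} \<and>
     sym (snd G) \<and> irrefl (snd G)"

definition graph_iso :: "nat \<times> (nat \<times> nat) set \<Rightarrow> nat \<times> (nat \<times> nat) set \<Rightarrow> bool" where
  "graph_iso G H \<longleftrightarrow> (\<exists>\<pi>. bij_betw \<pi> {..<fst G} {..<fst H} \<and>
     snd H = (\<lambda>(a, b). (\<pi> a, \<pi> b)) ` snd G)"

definition graph_measure :: "nat \<times> (nat \<times> nat) set \<Rightarrow> nat measure" where
  "graph_measure G = uniform_count_measure {..<fst G}"

definition graph_operator :: "nat \<times> (nat \<times> nat) set \<Rightarrow> (nat \<Rightarrow> real) \<Rightarrow> (nat \<Rightarrow> real)" where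
  "graph_operator G v = (\<lambda>i. \<Sum>j\<in>{j. j < fst G \<and> (j, i) \<in> snd G}. v j)"

end

(* The limit is built as an ultraproduct. Fix a nonprincipal ultrafilter U on the indices and let
   the uniform measures on the vertex sets induce the Loeb measure L on the space of vertex
   sequences; this space has the cardinality of the continuum, so real numbers can serve as its
   points. Every bounded measurable f on L is almost everywhere the U-limit of bounded functions v_i
   on the graphs, and the limit operator sends f to the U-limit of v_i A_i. The (p,q)-bound makes
   this independent of the choice of the v_i, and q > 1 gives uniform integrability, hence
   convergence of integrals and self-adjointness of the limit. Passing to U-limits matches the
   profiles of the A_i with those of the limit along U; the Cauchy property of the profiles upgrades
   this to genuine convergence. *)

theory Submission
  imports Defs
begin

section \<open>Ultrafilters\<close>

text \<open>A profile records the joint law of test functions together with their images, and weak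
  limits of the test functions would lose that information. On the ultraproduct both have pointwise
  limits on one probability space, so joint laws pass to the limit coordinatewise. The price is that
  a measurable function on the limit space has many preimages, its lifts. Two bounded lifts of it
  differ by a sequence tending to 0 almost everywhere; finiteness of \<open>p\<close> turns this
  into convergence in \<open>p\<close>-th mean, and the operator bound carries it to the images.
  Vertex sequences that agree along U are not identified: every construction sees only what holds
  eventually along U, so a surjection from the reals onto all sequences serves as well as the
  quotient. Countable saturation takes the place of a topology: it gives countable additivity of the
  Loeb measure and replaces a countable union of internal sets by one internal set up to a null
  set.\<close>

lemma ultrafilter_extension:
  fixes F :: "'a filter"
  assumes "F \<noteq> bot"
  obtains U where "U \<le> F" "U \<noteq> bot" "\<And>P. eventually P U \<or> eventually (\<lambda>x. \<not> P x) U"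
proof -
  let ?A = "{V. V \<le> F \<and> V \<noteq> bot}"
  let ?R = "relation_of (\<ge>) ?A"
  \<comment> \<open>A finer filter is smaller in the filter order, so the Zorn order is
    \<open>\<ge>\<close> and a chain is bounded by its infimum, which stays proper because its
    members are directed.\<close>
  have "\<exists>m\<in>?A. \<forall>a\<in>?A. m \<ge> a \<longrightarrow> a = m"
  proof (rule predicate_Zorn)
    show "partial_order_on ?A ?R"
      by (rule partial_order_on_relation_ofI) auto
    fix C assume C: "C \<in> Chains ?R"
    then have sub: "C \<subseteq> ?A" and lin: "\<And>a b. a \<in> C \<Longrightarrow> b \<in> C \<Longrightarrow> a \<le> b \<or> b \<le> a"
      by (auto simp: Chains_def relation_of_def)
    show "\<exists>u\<in>?A. \<forall>a\<in>C. a \<ge> u"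
    proof (cases "C = {}")
      case True
      then show ?thesis using assms by auto
    next
      case False
      have "eventually P (Inf C) \<longleftrightarrow> (\<exists>b\<in>C. eventually P b)" for P
        by (intro eventually_Inf_base) (use False in simp, use lin in \<open>metis le_inf_iff order_refl\<close>)
      then have "Inf C \<noteq> bot"
        using sub unfolding trivial_limit_def by auto
      moreover have "Inf C \<le> F"
        using False sub by (blast intro: Inf_lower2)
      ultimately show ?thesis by (auto intro: Inf_lower)
    qed
  qed
  then obtain U where U: "U \<le> F" "U \<noteq> bot"
    and max: "\<And>V. V \<le> U \<Longrightarrow> V \<noteq> bot \<Longrightarrow> V = U"
    by (auto intro: order_trans)
  have "eventually P U \<or> eventually (\<lambda>x. \<not> P x) U" for P
  proof (rule disjCI)
    assume np: "\<not> eventually (\<lambda>x. \<not> P x) U"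
    \<comment> \<open>Adjoining \<open>P\<close> keeps the filter proper when the negation of
      \<open>P\<close> is not eventual; minimality then says that nothing was added.\<close>
    let ?V = "inf U (principal {x. P x})"
    have "?V \<noteq> bot"
      using np by (auto simp: trivial_limit_def eventually_inf_principal)
    then have "?V = U" by (intro max) auto
    moreover have "eventually P ?V" by (simp add: eventually_inf_principal)
    ultimately show "eventually P U" by simp
  qed
  then show ?thesis using that U by blast
qed

text \<open>A sequence is determined by its graph, which pairing codes as a set of naturals and
  hence as a real. Inverting this injection lets every sequence of vertices be named by a
  real.\<close>

lemma surj_real_sequences: "\<exists>h :: real \<Rightarrow> nat \<Rightarrow> nat. surj h"
proof -
  obtain g :: "nat set \<Rightarrow> real" where "bij g"
    using nat_sets_eqpoll_reals by (auto simp: eqpoll_def)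
  then have inj: "inj g" by (rule bij_is_inj)
  define graph :: "(nat \<Rightarrow> nat) \<Rightarrow> nat set" where "graph s = range (\<lambda>n. prod_encode (n, s n))" for s
  have "inj graph"
  proof (rule injI)
    fix s t :: "nat \<Rightarrow> nat" assume eq: "graph s = graph t"
    have "s n = t n" for n
    proof -
      have "prod_encode (n, s n) \<in> graph t"
        unfolding eq[symmetric] by (auto simp: graph_def)
      then show ?thesis by (auto simp: graph_def)
    qed
    then show "s = t" by blast
  qed
  then have "surj (inv (g \<circ> graph))"
    using inj by (intro inj_imp_surj_inv inj_compose)
  then show ?thesis by blast
qed

locale ultra =
  fixes U :: "nat filter"
  assumes U_le: "U \<le> sequentially" and U_nonbot: "U \<noteq> bot"
    and U_ultra: "\<And>Q. eventually Q U \<or> eventually (\<lambda>i. \<not> Q i) U"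
begin

lemma U_seq: "eventually Q sequentially \<Longrightarrow> eventually Q U"
  using U_le by (rule filter_leD)

lemma not_U: "\<not> eventually Q U \<longleftrightarrow> eventually (\<lambda>i. \<not> Q i) U"
proof
  assume "eventually (\<lambda>i. \<not> Q i) U"
  then show "\<not> eventually Q U"
    using U_nonbot eventually_frequently not_eventually by blast
qed (use U_ultra in blast)

text \<open>Compactness of an interval gives a cluster point, and an ultrafilter converges to each
  of its cluster points: a neighbourhood that is not eventually entered is eventually
  avoided.\<close>

lemma bounded_convergent:
  fixes f :: "nat \<Rightarrow> real"
  assumes "\<forall>\<^sub>F i in U. \<bar>f i\<bar> \<le> C"
  shows "\<exists>l. (f \<longlongrightarrow> l) U"
proof -
  have "compact {-C..C}" by simp
  moreover have "filtermap f U \<noteq> bot" using U_nonbot by (simp add: filtermap_bot_iff)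
  moreover have "\<forall>\<^sub>F x in filtermap f U. x \<in> {-C..C}"
    unfolding eventually_filtermap by (rule eventually_mono[OF assms]) auto
  ultimately obtain l where l: "inf (nhds l) (filtermap f U) \<noteq> bot"
    by (auto simp: compact_filter)
  have "eventually (\<lambda>i. f i \<in> S) U" if S: "open S" "l \<in> S" for S
  proof (rule ccontr)
    assume "\<not> eventually (\<lambda>i. f i \<in> S) U"
    then have "eventually (\<lambda>x. x \<notin> S) (filtermap f U)"
      by (simp add: not_U eventually_filtermap)
    moreover have "eventually (\<lambda>x. x \<in> S) (nhds l)"
      using S by (rule eventually_nhds_in_open)
    ultimately have "eventually (\<lambda>x. False) (inf (nhds l) (filtermap f U))"
      unfolding eventually_inf by (intro exI[of _ "\<lambda>x. x \<in> S"] exI[of _ "\<lambda>x. x \<notin> S"]) auto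
    with l show False by (simp add: trivial_limit_def)
  qed
  then show ?thesis by (auto simp: tendsto_def)
qed

text \<open>Overspill in combinatorial form: countably many eventual properties are met by letting
  the number of properties demanded at \<open>i\<close> grow with \<open>i\<close>. The first
  conclusion holds at every index; only the growth of \<open>s\<close> is eventual.\<close>

lemma diagonal:
  assumes "\<And>m::nat. \<forall>\<^sub>F i in U. Q m i"
  obtains s :: "nat \<Rightarrow> nat" where "\<And>i k. k < s i \<Longrightarrow> Q k i" "\<And>m. \<forall>\<^sub>F i in U. m \<le> s i"
proof
  \<comment> \<open>The cap \<open>m \<le> i\<close> makes the maximum exist, and it still tends to
    infinity along U because U refines \<open>sequentially\<close>.\<close>
  define s where "s i = Max {m. m \<le> i \<and> (\<forall>k<m. Q k i)}" for i
  have fin: "finite {m. m \<le> i \<and> (\<forall>k<m. Q k i)}" for i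
    by (rule finite_subset[of _ "{..i}"]) auto
  have ne: "{m. m \<le> i \<and> (\<forall>k<m. Q k i)} \<noteq> {}" for i
    by (auto intro: exI[of _ 0])
  show "Q k i" if "k < s i" for i k
    using Max_in[OF fin ne] that unfolding s_def by auto
  show "\<forall>\<^sub>F i in U. m \<le> s i" for m
  proof -
    have "\<forall>\<^sub>F i in U. \<forall>k\<in>{..<m}. Q k i"
      using assms by (intro eventually_ball_finite) auto
    moreover have "\<forall>\<^sub>F i in U. m \<le> i"
      by (rule U_seq) (rule eventually_ge_at_top)
    ultimately show ?thesis
      by eventually_elim (auto simp: s_def intro!: Max_ge fin)
  qed
qed

lemma eventually_disj: "eventually (\<lambda>i. Q i \<or> R i) U \<longleftrightarrow> eventually Q U \<or> eventually R U"
proof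
  assume "eventually (\<lambda>i. Q i \<or> R i) U"
  then show "eventually Q U \<or> eventually R U"
    using not_U[of "\<lambda>i. Q i \<or> R i"] not_U[of Q] not_U[of R] by (auto simp: eventually_conj_iff)
qed (auto elim: eventually_mono)

text \<open>Primeness of the ultrafilter, iterated: a witness from a finite set that varies with
  \<open>i\<close> can be frozen. Finite-valued functions and finite grids of cells pass to the
  limit through this.\<close>

lemma eventually_bex_finite:
  assumes "finite K"
  shows "(\<forall>\<^sub>F i in U. \<exists>k\<in>K. Q k i) \<longleftrightarrow> (\<exists>k\<in>K. \<forall>\<^sub>F i in U. Q k i)"
  using assms by induction (auto simp: eventually_disj U_nonbot)

end

section \<open>Loeb measures\<close>

text \<open>Doubling \<open>z\<close> doubles its floor and adds the parity of the new floor, which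
  is the next digit. The digits start at exponent 1 because \<open>y\<close> has integer part
  0.\<close>

lemma binary_digit_sum:
  fixes y :: real
  assumes "0 \<le> y" "y < 1"
  shows "(\<Sum>j<J. (1/2 :: real) ^ Suc j * of_bool (odd \<lfloor>2 ^ Suc j * y\<rfloor>)) = of_int \<lfloor>2 ^ J * y\<rfloor> / 2 ^ J"
proof (induction J)
  case 0
  have "\<lfloor>y\<rfloor> = 0" using assms by (simp add: floor_eq_iff)
  then show ?case by simp
next
  case (Suc J)
  define z where "z = 2 ^ J * y"
  have "\<lfloor>2 * z\<rfloor> = 2 * \<lfloor>z\<rfloor> \<or> \<lfloor>2 * z\<rfloor> = 2 * \<lfloor>z\<rfloor> + 1"
    by linarith
  then have "of_int \<lfloor>2 * z\<rfloor> = 2 * of_int \<lfloor>z\<rfloor> + (of_bool (odd \<lfloor>2 * z\<rfloor>) :: real)"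
    by auto
  moreover have "2 ^ Suc J * y = 2 * z" by (simp add: z_def)
  ultimately show ?case
    using Suc by (simp add: z_def power_one_over field_simps)
qed

text \<open>Beyond the level \<open>R\<close> one writes \<bar>y\<bar> as \<bar>y\<bar> powr q times
  \<bar>y\<bar> powr (1 - q), and the second exponent is negative. Bounded \<open>q\<close>-th
  moments thus make truncation errors uniformly small in mean as \<open>R\<close> grows.\<close>

lemma truncation_error:
  fixes y R q :: real
  assumes R: "0 < R" and q: "1 < q"
  shows "\<bar>y - max (- R) (min R y)\<bar> \<le> \<bar>y\<bar> powr q * R powr (1 - q)"
proof (cases "\<bar>y\<bar> \<le> R")
  case True
  then have "y - max (- R) (min R y) = 0" by auto
  then show ?thesis by simp
next
  case False
  then have "\<bar>y\<bar> powr (1 - q) \<le> R powr (1 - q)"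
    using R q by (intro powr_mono2') auto
  then have "\<bar>y\<bar> powr q * \<bar>y\<bar> powr (1 - q) \<le> \<bar>y\<bar> powr q * R powr (1 - q)"
    by (rule mult_left_mono) simp
  moreover have "\<bar>y\<bar> powr q * \<bar>y\<bar> powr (1 - q) = \<bar>y\<bar>"
    using False R by (simp flip: powr_add)
  moreover have "\<bar>y - max (- R) (min R y)\<bar> \<le> \<bar>y\<bar>" using R by auto
  ultimately show ?thesis by linarith
qed

lemma le_one_plus_powr:
  fixes y q :: real
  assumes "1 < q"
  shows "\<bar>y\<bar> \<le> 1 + \<bar>y\<bar> powr q"
proof (cases "\<bar>y\<bar> \<le> 1")
  case True
  then show ?thesis using powr_ge_zero[of "\<bar>y\<bar>" q] by linarith
next
  case False
  then have "\<bar>y\<bar> powr 1 \<le> \<bar>y\<bar> powr q" using assms by (intro powr_mono) auto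
  then show ?thesis using False by simp
qed

text \<open>A point \<open>b\<close> names the sequence \<open>pt b\<close>. Surjectivity is what
  allows points of the limit space to be chosen coordinate by coordinate.\<close>

locale loeb = ultra U for U :: "nat filter" +
  fixes P :: "nat \<Rightarrow> 'a measure" and pt :: "'b \<Rightarrow> nat \<Rightarrow> 'a"
  assumes prob_P: "\<And>i. prob_space (P i)" and surj_pt: "surj pt"
begin

section \<open>Internal sets and the transfer of set operations\<close>

definition internal :: "(nat \<Rightarrow> 'a set) \<Rightarrow> 'b set" where
  "internal A = {b. \<forall>\<^sub>F i in U. pt b i \<in> A i}"

lemma choose_point:
  assumes "\<forall>\<^sub>F i in U. \<exists>x. R i x"
  obtains b where "\<forall>\<^sub>F i in U. R i (pt b i)"
proof -
  obtain b where b: "pt b = (\<lambda>i. SOME x. R i x)"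
    using surj_pt by (metis surj_def)
  have "\<forall>\<^sub>F i in U. R i (pt b i)"
    unfolding b using assms by eventually_elim (rule someI_ex)
  then show ?thesis by (rule that)
qed

text \<open>If inclusion is not eventual, then along U there is eventually a vertex violating it; a
  point naming such a choice of vertices separates the two internal sets.\<close>

lemma internal_subset_iff: "internal A \<subseteq> internal B \<longleftrightarrow> (\<forall>\<^sub>F i in U. A i \<subseteq> B i)"
proof
  assume sub: "internal A \<subseteq> internal B"
  show "\<forall>\<^sub>F i in U. A i \<subseteq> B i"
  proof (rule ccontr)
    assume "\<not> (\<forall>\<^sub>F i in U. A i \<subseteq> B i)"
    then have "\<forall>\<^sub>F i in U. \<exists>x. x \<in> A i - B i"
      unfolding not_U by (rule eventually_mono) auto
    then obtain b where b: "\<forall>\<^sub>F i in U. pt b i \<in> A i - B i"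
      by (rule choose_point)
    have "b \<in> internal A" using b unfolding internal_def by (auto elim: eventually_mono)
    moreover have "b \<notin> internal B" using b
      unfolding internal_def by (auto simp: not_U elim: eventually_mono)
    ultimately show False using sub by auto
  qed
next
  assume "\<forall>\<^sub>F i in U. A i \<subseteq> B i"
  then show "internal A \<subseteq> internal B"
    unfolding internal_def by (auto elim: eventually_elim2)
qed

lemma internal_eq_iff: "internal A = internal B \<longleftrightarrow> (\<forall>\<^sub>F i in U. A i = B i)"
  by (simp add: set_eq_subset internal_subset_iff eventually_conj_iff)

lemma internal_Un: "internal (\<lambda>i. A i \<union> B i) = internal A \<union> internal B"
  by (auto simp: internal_def eventually_disj)

lemma internal_Int: "internal (\<lambda>i. A i \<inter> B i) = internal A \<inter> internal B"
  by (auto simp: internal_def eventually_conj_iff)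

lemma internal_Diff: "internal (\<lambda>i. A i - B i) = internal A - internal B"
  by (auto simp: internal_def eventually_conj_iff simp flip: not_U)

lemma internal_empty: "internal (\<lambda>i. {}) = {}"
  using U_nonbot by (auto simp: internal_def)

lemma internal_UN:
  assumes "finite J"
  shows "internal (\<lambda>i. \<Union>j\<in>J. A j i) = (\<Union>j\<in>J. internal (A j))"
  using assms
proof (induction J)
  case empty
  then show ?case by (simp add: internal_empty)
next
  case (insert j J)
  then show ?case by (simp add: internal_Un)
qed

section \<open>The Loeb premeasure and its countably additive extension\<close>

definition imeasurable :: "(nat \<Rightarrow> 'a set) \<Rightarrow> bool" where
  "imeasurable A \<longleftrightarrow> (\<forall>i. A i \<in> sets (P i))"

definition \<Omega> :: "'b set" where "\<Omega> = internal (\<lambda>i. space (P i))"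

definition internals :: "'b set set" where "internals = {internal A | A. imeasurable A}"

definition content :: "(nat \<Rightarrow> 'a set) \<Rightarrow> real" where
  "content A = Lim U (\<lambda>i. measure (P i) (A i))"

lemma tendsto_content: "((\<lambda>i. measure (P i) (A i)) \<longlongrightarrow> content A) U"
proof -
  have "\<forall>\<^sub>F i in U. \<bar>measure (P i) (A i)\<bar> \<le> 1"
    using prob_P by (simp add: prob_space.prob_le_1)
  from bounded_convergent[OF this] obtain l where "((\<lambda>i. measure (P i) (A i)) \<longlongrightarrow> l) U"
    by blast
  then show ?thesis
    using tendsto_Lim[OF _ \<open>(_ \<longlongrightarrow> l) U\<close>] U_nonbot by (simp add: content_def)
qed

lemma content_eqI: "((\<lambda>i. measure (P i) (A i)) \<longlongrightarrow> l) U \<Longrightarrow> content A = l"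
  using tendsto_unique[OF U_nonbot] tendsto_content by blast

lemma content_nonneg: "0 \<le> content A"
  by (rule tendsto_lowerbound[OF tendsto_content _ U_nonbot]) simp

definition premeasure :: "'b set \<Rightarrow> ennreal" where
  "premeasure X = ennreal (content (SOME A. imeasurable A \<and> X = internal A))"

text \<open>Independence of the representing sequence: two representatives of one internal set agree
  eventually along U, so their measures have the same limit.\<close>

lemma premeasure_internal:
  assumes "imeasurable A"
  shows "premeasure (internal A) = ennreal (content A)"
proof -
  define B where "B = (SOME B. imeasurable B \<and> internal A = internal B)"
  have "imeasurable B \<and> internal A = internal B"
    unfolding B_def by (rule someI[of _ A]) (use assms in simp)
  then have "\<forall>\<^sub>F i in U. A i = B i" by (simp add: internal_eq_iff)
  then have "((\<lambda>i. measure (P i) (A i)) \<longlongrightarrow> content B) U"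
    by (intro Lim_transform_eventually[OF tendsto_content[of B]]) (auto elim: eventually_mono)
  then show ?thesis by (simp add: premeasure_def content_eqI flip: B_def)
qed

lemma ring_internals: "ring_of_sets \<Omega> internals"
proof (rule ring_of_setsI)
  show "internals \<subseteq> Pow \<Omega>"
    using sets.sets_into_space
    by (fastforce simp: internals_def \<Omega>_def imeasurable_def internal_def elim: eventually_mono)
  show "{} \<in> internals"
    unfolding internals_def by (auto simp: imeasurable_def intro!: exI[of _ "\<lambda>i. {}"] internal_empty[symmetric])
  fix a b assume "a \<in> internals" "b \<in> internals"
  then obtain A B where AB: "a = internal A" "b = internal B" "imeasurable A" "imeasurable B"
    by (auto simp: internals_def)
  show "a \<union> b \<in> internals"
    unfolding internals_def using AB
    by (auto simp: imeasurable_def internal_Un intro!: exI[of _ "\<lambda>i. A i \<union> B i"])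
  show "a - b \<in> internals"
    unfolding internals_def using AB
    by (auto simp: imeasurable_def internal_Diff intro!: exI[of _ "\<lambda>i. A i - B i"])
qed

lemma additive_premeasure: "additive internals premeasure"
  unfolding additive_def
proof (intro ballI impI)
  fix x y assume "x \<in> internals" "y \<in> internals" and disj: "x \<inter> y = {}"
  then obtain A B where AB: "x = internal A" "y = internal B" "imeasurable A" "imeasurable B"
    by (auto simp: internals_def)
  have AB_im: "imeasurable (\<lambda>i. A i \<union> B i)" using AB by (simp add: imeasurable_def)
  have "internal (\<lambda>i. A i \<inter> B i) = internal (\<lambda>i. {})"
    using disj AB by (simp add: internal_Int internal_empty)
  then have "\<forall>\<^sub>F i in U. A i \<inter> B i = {}" by (simp add: internal_eq_iff)
  then have "\<forall>\<^sub>F i in U. measure (P i) (A i) + measure (P i) (B i) = measure (P i) (A i \<union> B i)"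
  proof eventually_elim
    case (elim i)
    interpret prob_space "P i" by (rule prob_P)
    show ?case using AB elim by (simp add: finite_measure_Union imeasurable_def)
  qed
  then have "content (\<lambda>i. A i \<union> B i) = content A + content B"
    by (intro content_eqI Lim_transform_eventually[OF tendsto_add[OF tendsto_content tendsto_content]])
  then show "premeasure (x \<union> y) = premeasure x + premeasure y"
    using AB AB_im
    by (simp add: premeasure_internal content_nonneg flip: internal_Un)
qed

text \<open>If every \<open>X n\<close> had a point, the representing sets would be nonempty and
  nested up to a depth \<open>s i\<close> that is unbounded along U. A point chosen at index
  \<open>i\<close> in the deepest set still under control lies in all \<open>X n\<close> at
  once.\<close>

lemma countable_saturation:
  assumes im: "range X \<subseteq> internals" and dec: "decseq X" and empty: "(\<Inter>n. X n) = {}"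
  obtains n where "X n = {}"
proof (rule ccontr)
  assume "\<not> thesis"
  then have ne: "X n \<noteq> {}" for n using that by blast
  have "\<forall>n. \<exists>A. X n = internal A" using im by (auto simp: internals_def image_subset_iff)
  then obtain A where A: "\<And>n. X n = internal (A n)" by metis
  have "\<forall>\<^sub>F i in U. A n i \<noteq> {}" for n
  proof -
    have "\<not> internal (A n) = internal (\<lambda>i. {})" using ne[of n] by (simp add: A internal_empty)
    then show ?thesis by (simp add: internal_eq_iff not_U)
  qed
  moreover have "\<forall>\<^sub>F i in U. \<forall>k\<in>{..n}. A n i \<subseteq> A k i" for n
  proof (intro eventually_ball_finite ballI)
    fix k assume "k \<in> {..n}"
    then have "internal (A n) \<subseteq> internal (A k)" using dec by (simp add: decseq_def flip: A)
    then show "\<forall>\<^sub>F i in U. A n i \<subseteq> A k i" by (simp add: internal_subset_iff)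
  qed simp
  ultimately have "\<forall>\<^sub>F i in U. A n i \<noteq> {} \<and> (\<forall>k\<in>{..n}. A n i \<subseteq> A k i)" for n
    by (simp add: eventually_conj_iff)
  then obtain s where s: "\<And>i k. k < s i \<Longrightarrow> A k i \<noteq> {} \<and> (\<forall>l\<in>{..k}. A k i \<subseteq> A l i)"
    and s_inf: "\<And>m. \<forall>\<^sub>F i in U. m \<le> s i"
    by (rule diagonal[of "\<lambda>n i. A n i \<noteq> {} \<and> (\<forall>k\<in>{..n}. A n i \<subseteq> A k i)"]) blast
  \<comment> \<open>The deepest controlled set has index \<open>s i - 1\<close>, which is below
    \<open>s i\<close> only once \<open>s i\<close> is at least 1.\<close>
  have "\<forall>\<^sub>F i in U. \<exists>x. x \<in> A (s i - 1) i"
    using s_inf[of 1]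
  proof eventually_elim
    case (elim i)
    then have "A (s i - 1) i \<noteq> {}" using s[of "s i - 1" i] by simp
    then show ?case by blast
  qed
  then obtain b where b: "\<forall>\<^sub>F i in U. pt b i \<in> A (s i - 1) i"
    by (rule choose_point)
  have "b \<in> X n" for n
    unfolding A internal_def mem_Collect_eq using b s_inf[of "Suc n"]
  proof eventually_elim
    case (elim i)
    then show ?case using s[of "s i - 1" i] by auto
  qed
  then show False using empty by blast
qed

text \<open>Caratheodory asks for continuity at the empty set. By saturation a decreasing sequence
  of internal sets with empty intersection is already empty from some index on.\<close>

lemma premeasure_extends:
  "\<exists>\<mu>. (\<forall>s\<in>internals. \<mu> s = premeasure s) \<and> measure_space \<Omega> (sigma_sets \<Omega> internals) \<mu>"
proof (rule ring_of_sets.caratheodory_empty_continuous[OF ring_internals])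
  have "premeasure {} = 0"
    using premeasure_internal[of "\<lambda>i. {}"] content_eqI[of "\<lambda>i. {}" 0]
    by (simp add: imeasurable_def internal_empty)
  then show "positive internals premeasure" by (simp add: positive_def)
  show "additive internals premeasure" by (rule additive_premeasure)
  show "premeasure A \<noteq> \<infinity>" for A by (simp add: premeasure_def)
  fix X :: "nat \<Rightarrow> 'b set" assume X: "range X \<subseteq> internals" "decseq X" "(\<Inter>i. X i) = {}"
  then obtain n where n: "X n = {}" by (rule countable_saturation)
  have "\<forall>\<^sub>F m in sequentially. premeasure (X m) = 0"
    using eventually_ge_at_top[of n]
  proof eventually_elim
    case (elim m)
    then have "X m \<subseteq> X n" using X(2) by (simp add: decseq_def)
    then show ?case using n \<open>premeasure {} = 0\<close> by simp
  qed
  then show "(\<lambda>m. premeasure (X m)) \<longlonglongrightarrow> 0" by (rule tendsto_eventually)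
qed

definition extension :: "'b set \<Rightarrow> ennreal" where
  "extension = (SOME \<mu>. (\<forall>s\<in>internals. \<mu> s = premeasure s) \<and>
     measure_space \<Omega> (sigma_sets \<Omega> internals) \<mu>)"

lemma extension:
  "s \<in> internals \<Longrightarrow> extension s = premeasure s"
  "measure_space \<Omega> (sigma_sets \<Omega> internals) extension"
  using someI_ex[OF premeasure_extends] unfolding extension_def[symmetric] by auto

definition L :: "'b measure" where
  "L = measure_of \<Omega> internals extension"

lemma internals_Pow: "internals \<subseteq> Pow \<Omega>"
  using ring_internals by (simp add: ring_of_sets_def semiring_of_sets_def subset_class_def)

lemma space_L: "space L = \<Omega>"
  by (simp add: L_def space_measure_of_conv)

lemma sets_L: "sets L = sigma_sets \<Omega> internals"
  using internals_Pow by (simp add: L_def)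

lemma internal_sets [measurable]: "imeasurable A \<Longrightarrow> internal A \<in> sets L"
  unfolding sets_L by (auto simp: internals_def)

lemma emeasure_internal:
  assumes "imeasurable A"
  shows "emeasure L (internal A) = ennreal (content A)"
proof -
  have A: "internal A \<in> internals" using assms by (auto simp: internals_def)
  have "emeasure L (internal A) = extension (internal A)"
    using extension(2) internals_Pow internal_sets[OF assms]
    by (intro emeasure_measure_of[OF L_def]) (auto simp: measure_space_def sets_L)
  then show ?thesis
    using extension(1)[OF A] premeasure_internal[OF assms] by simp
qed

lemma tendsto_measure_internal:
  "imeasurable A \<Longrightarrow> ((\<lambda>i. measure (P i) (A i)) \<longlongrightarrow> measure L (internal A)) U"
  using tendsto_content[of A] by (simp add: measure_def[of L] emeasure_internal content_nonneg)

lemma imeasurable_space: "imeasurable (\<lambda>i. space (P i))"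
  by (simp add: imeasurable_def)

sublocale L: prob_space L
proof
  have "content (\<lambda>i. space (P i)) = 1"
    by (intro content_eqI) (simp add: prob_space.prob_space[OF prob_P])
  then show "emeasure L (space L) = 1"
    unfolding space_L \<Omega>_def by (simp add: emeasure_internal imeasurable_space)
qed

lemma in_space_L: "b \<in> space L \<longleftrightarrow> (\<forall>\<^sub>F i in U. pt b i \<in> space (P i))"
  by (simp add: space_L \<Omega>_def internal_def)

lemma internal_subset_space: "imeasurable A \<Longrightarrow> internal A \<subseteq> space L"
  using sets.sets_into_space internal_sets by blast

lemma internal_Collect:
  assumes "\<And>i. {x\<in>space (P i). Q i x} \<in> sets (P i)"
  shows "{b\<in>space L. \<forall>\<^sub>F i in U. Q i (pt b i)} = internal (\<lambda>i. {x\<in>space (P i). Q i x})"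
  by (auto simp: in_space_L internal_def eventually_conj_iff)

lemma sets_eventually [measurable (raw)]:
  assumes "\<And>i. {x\<in>space (P i). Q i x} \<in> sets (P i)"
  shows "{b\<in>space L. \<forall>\<^sub>F i in U. Q i (pt b i)} \<in> sets L"
  unfolding internal_Collect[OF assms] using assms by (intro internal_sets) (simp add: imeasurable_def)

lemma tendsto_measure_eventually:
  assumes "\<And>i. {x\<in>space (P i). Q i x} \<in> sets (P i)"
  shows "((\<lambda>i. measure (P i) {x\<in>space (P i). Q i x}) \<longlongrightarrow>
    measure L {b\<in>space L. \<forall>\<^sub>F i in U. Q i (pt b i)}) U"
  unfolding internal_Collect[OF assms] using assms
  by (intro tendsto_measure_internal) (simp add: imeasurable_def)

lemma AE_eventuallyI:
  assumes Q: "\<And>i. {x\<in>space (P i). Q i x} \<in> sets (P i)"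
    and lim: "((\<lambda>i. measure (P i) {x\<in>space (P i). Q i x}) \<longlongrightarrow> 1) U"
  shows "AE b in L. \<forall>\<^sub>F i in U. Q i (pt b i)"
proof -
  have "measure L {b\<in>space L. \<forall>\<^sub>F i in U. Q i (pt b i)} = 1"
    using tendsto_unique[OF U_nonbot tendsto_measure_eventually[of Q, OF Q] lim] .
  then show ?thesis
    by (subst (asm) L.prob_Collect_eq_1) (use sets_eventually[of Q, OF Q] in simp_all)
qed

lemma AE_eventually:
  assumes "\<And>i. {x\<in>space (P i). Q i x} \<in> sets (P i)" and "\<And>i. AE x in P i. Q i x"
  shows "AE b in L. \<forall>\<^sub>F i in U. Q i (pt b i)"
proof (rule AE_eventuallyI)
  have "measure (P i) {x\<in>space (P i). Q i x} = 1" for i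
    using assms by (subst prob_space.prob_Collect_eq_1[OF prob_P]) auto
  then show "((\<lambda>i. measure (P i) {x\<in>space (P i). Q i x}) \<longlongrightarrow> 1) U" by simp
qed fact

section \<open>Standard parts of sequences of functions\<close>

definition fin :: "(nat \<Rightarrow> 'a \<Rightarrow> real) \<Rightarrow> 'b \<Rightarrow> bool" where
  "fin f b \<longleftrightarrow> (\<exists>n::nat. \<forall>\<^sub>F i in U. \<bar>f i (pt b i)\<bar> \<le> real n)"

text \<open>The value 0 off the points where the sequence stays bounded is arbitrary.\<close>
definition std :: "(nat \<Rightarrow> 'a \<Rightarrow> real) \<Rightarrow> 'b \<Rightarrow> real" where
  "std f b = (if fin f b then Lim U (\<lambda>i. f i (pt b i)) else 0)"

lemma finI: "\<forall>\<^sub>F i in U. \<bar>f i (pt b i)\<bar> \<le> C \<Longrightarrow> fin f b"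
  unfolding fin_def
  by (rule exI[of _ "nat \<lceil>C\<rceil>"]) (auto elim!: eventually_mono intro: order_trans real_nat_ceiling_ge)

lemma std_eqI: "((\<lambda>i. f i (pt b i)) \<longlongrightarrow> l) U \<Longrightarrow> std f b = l"
proof -
  assume lim: "((\<lambda>i. f i (pt b i)) \<longlongrightarrow> l) U"
  have "\<forall>\<^sub>F i in U. dist (f i (pt b i)) l < 1" using lim by (rule tendstoD) simp
  then have "\<forall>\<^sub>F i in U. \<bar>f i (pt b i)\<bar> \<le> \<bar>l\<bar> + 1"
    by eventually_elim (auto simp: dist_real_def)
  then have "fin f b" by (rule finI)
  then show ?thesis using tendsto_Lim[OF _ lim] U_nonbot by (simp add: std_def)
qed

lemma tendsto_std: "fin f b \<Longrightarrow> ((\<lambda>i. f i (pt b i)) \<longlongrightarrow> std f b) U"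
proof -
  assume "fin f b"
  then have "\<exists>l. ((\<lambda>i. f i (pt b i)) \<longlongrightarrow> l) U"
    unfolding fin_def by (elim exE) (rule bounded_convergent)
  then obtain l where "((\<lambda>i. f i (pt b i)) \<longlongrightarrow> l) U" by blast
  then show ?thesis using std_eqI by simp
qed

definition ifun :: "(nat \<Rightarrow> 'a \<Rightarrow> real) \<Rightarrow> bool" where
  "ifun f \<longleftrightarrow> (\<forall>i. f i \<in> borel_measurable (P i))"

lemma ifunD [measurable_dest]: "ifun f \<Longrightarrow> f i \<in> borel_measurable (P i)"
  by (simp add: ifun_def)

lemma measurable_fin:
  assumes [measurable]: "ifun f"
  shows "{b\<in>space L. fin f b} \<in> sets L"
proof -
  have "{b\<in>space L. fin f b} = (\<Union>n. {b\<in>space L. \<forall>\<^sub>F i in U. \<bar>f i (pt b i)\<bar> \<le> real n})"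
    by (auto simp: fin_def)
  also have "\<dots> \<in> sets L"
  proof (intro sets.countable_UN image_subsetI)
    show "{b\<in>space L. \<forall>\<^sub>F i in U. \<bar>f i (pt b i)\<bar> \<le> real n} \<in> sets L" for n
      by (intro sets_eventually) measurable
  qed
  finally show ?thesis .
qed

text \<open>A limit at most \<open>a\<close> does not force the terms below \<open>a\<close>, hence
  the slack. A countable family of slacks suffices, so sublevel sets of standard parts are built
  from countably many internal sets.\<close>

lemma std_le_iff:
  assumes "fin f b"
  shows "std f b \<le> a \<longleftrightarrow> (\<forall>m::nat. \<forall>\<^sub>F i in U. f i (pt b i) \<le> a + inverse (real (Suc m)))"
proof
  assume le: "std f b \<le> a"
  show "\<forall>m::nat. \<forall>\<^sub>F i in U. f i (pt b i) \<le> a + inverse (real (Suc m))"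
  proof
    fix m :: nat
    have "\<forall>\<^sub>F i in U. f i (pt b i) < a + inverse (real (Suc m))"
      using le by (intro order_tendstoD(2)[OF tendsto_std[OF assms]]) (simp add: order.strict_trans1)
    then show "\<forall>\<^sub>F i in U. f i (pt b i) \<le> a + inverse (real (Suc m))" by (auto elim: eventually_mono)
  qed
next
  assume *: "\<forall>m::nat. \<forall>\<^sub>F i in U. f i (pt b i) \<le> a + inverse (real (Suc m))"
  have "std f b \<le> a + inverse (real (Suc m))" for m
    using * by (intro tendsto_upperbound[OF tendsto_std[OF assms] _ U_nonbot]) auto
  then have "(\<lambda>_. std f b) \<longlonglongrightarrow> std f b \<Longrightarrow> std f b \<le> a + 0"
    by (intro LIMSEQ_le[of "\<lambda>_. std f b" _ "\<lambda>m. a + inverse (real (Suc m))"] tendsto_add LIMSEQ_inverse_real_of_nat) auto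
  then show "std f b \<le> a" by simp
qed

lemma measurable_std [measurable]:
  assumes [measurable]: "ifun f"
  shows "std f \<in> borel_measurable L"
proof (subst borel_measurable_iff_le, intro allI)
  fix a
  let ?F = "{b\<in>space L. fin f b}"
  have le_iff: "std f b \<le> a \<longleftrightarrow>
    fin f b \<and> (\<forall>m::nat. \<forall>\<^sub>F i in U. f i (pt b i) \<le> a + inverse (real (Suc m))) \<or> \<not> fin f b \<and> 0 \<le> a" for b
    by (cases "fin f b") (simp add: std_le_iff del: of_nat_Suc, simp add: std_def)
  have "{b\<in>space L. std f b \<le> a} =
     (?F \<inter> (\<Inter>m::nat. {b\<in>space L. \<forall>\<^sub>F i in U. f i (pt b i) \<le> a + inverse (real (Suc m))})) \<union>
     (if 0 \<le> a then space L - ?F else {})"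
    using le_iff by (cases "0 \<le> a") (auto simp del: of_nat_Suc)
  also have "\<dots> \<in> sets L"
  proof -
    have "{b\<in>space L. \<forall>\<^sub>F i in U. f i (pt b i) \<le> a + inverse (real (Suc m))} \<in> sets L" for m
      by (intro sets_eventually) measurable
    then show ?thesis using measurable_fin[OF assms]
      by (intro sets.Un sets.Int) auto
  qed
  finally show "{b\<in>space L. std f b \<le> a} \<in> sets L" .
qed

text \<open>Markov's inequality handles each threshold, and countably many thresholds suffice.
  Unlike along ordinary sequences, convergence in mean gives almost sure convergence without passing
  to a subsequence, since the limit space turns probabilities tending to 1 into almost sure
  events.\<close>

lemma AE_tendsto_0:
  fixes g :: "nat \<Rightarrow> 'a \<Rightarrow> real"
  assumes g: "\<And>i. integrable (P i) (g i)" and nonneg: "\<And>i x. 0 \<le> g i x"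
    and lim: "((\<lambda>i. \<integral>x. g i x \<partial>P i) \<longlongrightarrow> 0) U"
  shows "AE b in L. ((\<lambda>i. g i (pt b i)) \<longlongrightarrow> 0) U"
proof -
  have [measurable]: "g i \<in> borel_measurable (P i)" for i using g by (rule borel_measurable_integrable)
  have "AE b in L. \<forall>\<^sub>F i in U. g i (pt b i) < inverse (real (Suc m))" for m
  proof (rule AE_eventuallyI)
    show "{x \<in> space (P i). g i x < inverse (real (Suc m))} \<in> sets (P i)" for i by measurable
    have lower: "1 - (\<integral>x. g i x \<partial>P i) / inverse (real (Suc m)) \<le> measure (P i) {x\<in>space (P i). g i x < inverse (real (Suc m))}" for i
    proof -
      interpret prob_space "P i" by (rule prob_P)
      have "prob {x\<in>space (P i). g i x < inverse (real (Suc m))} = 1 - prob {x\<in>space (P i). inverse (real (Suc m)) \<le> g i x}"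
      proof (subst prob_compl[symmetric])
        show "prob {x\<in>space (P i). g i x < inverse (real (Suc m))} =
          prob (space (P i) - {x\<in>space (P i). inverse (real (Suc m)) \<le> g i x})"
          by (rule arg_cong[where f=prob]) auto
      qed measurable
      moreover have "prob {x\<in>space (P i). inverse (real (Suc m)) \<le> g i x} \<le> (\<integral>x. g i x \<partial>P i) / inverse (real (Suc m))"
        by (rule integral_Markov_inequality_measure[where A="{}"]) (use g nonneg in auto)
      ultimately show ?thesis by simp
    qed
    have lim': "((\<lambda>i. 1 - (\<integral>x. g i x \<partial>P i) / inverse (real (Suc m))) \<longlongrightarrow> 1 - 0 / inverse (real (Suc m))) U"
      by (intro tendsto_intros lim) simp
    show "((\<lambda>i. measure (P i) {x\<in>space (P i). g i x < inverse (real (Suc m))}) \<longlongrightarrow> 1) U"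
    proof (rule tendsto_sandwich[OF always_eventually always_eventually])
      show "\<forall>i. 1 - (\<integral>x. g i x \<partial>P i) / inverse (real (Suc m))
        \<le> measure (P i) {x\<in>space (P i). g i x < inverse (real (Suc m))}"
        using lower by blast
      show "\<forall>i. measure (P i) {x\<in>space (P i). g i x < inverse (real (Suc m))} \<le> 1"
        by (simp add: prob_space.prob_le_1[OF prob_P])
    qed (use lim' in simp_all)
  qed
  then have "AE b in L. \<forall>m. \<forall>\<^sub>F i in U. g i (pt b i) < inverse (real (Suc m))"
    by (simp add: AE_all_countable)
  then show ?thesis
  proof eventually_elim
    case (elim b)
    show ?case
    proof (rule tendstoI)
      fix e :: real assume "0 < e"
      then obtain m where "inverse (real (Suc m)) < e" using reals_Archimedean by blast
      with elim[rule_format, of m] show "\<forall>\<^sub>F i in U. dist (g i (pt b i)) 0 < e"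
        by (auto simp: dist_real_def nonneg elim!: eventually_mono)
    qed
  qed
qed

text \<open>By Markov's inequality a uniform first-moment bound leaves at most mass
  \<open>K / (n + 1)\<close> above height \<open>n + 1\<close>, also in the limit.\<close>

lemma AE_fin:
  assumes g: "\<And>i. integrable (P i) (g i)"
    and bd: "\<And>i. (\<integral>x. \<bar>g i x\<bar> \<partial>P i) \<le> K"
  shows "AE b in L. fin g b"
proof -
  have im: "ifun g" using g by (auto simp: ifun_def)
  then have [measurable]: "g i \<in> borel_measurable (P i)" for i by (simp add: ifun_def)
  have "1 - K * inverse (real (Suc n)) \<le> measure L {b\<in>space L. fin g b}" for n
  proof -
    have "1 - K * inverse (real (Suc n)) \<le> measure (P i) {x\<in>space (P i). \<bar>g i x\<bar> \<le> real (Suc n)}" for i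
    proof -
      interpret prob_space "P i" by (rule prob_P)
      have "prob {x\<in>space (P i). \<bar>g i x\<bar> \<le> real (Suc n)} \<ge> 1 - prob {x\<in>space (P i). real (Suc n) \<le> \<bar>g i x\<bar>}"
        by (subst prob_compl[symmetric]) (auto intro!: finite_measure_mono)
      moreover have "prob {x\<in>space (P i). real (Suc n) \<le> \<bar>g i x\<bar>} \<le> (\<integral>x. \<bar>g i x\<bar> \<partial>P i) / real (Suc n)"
        by (rule integral_Markov_inequality_measure[where A="{}"]) (use g in auto)
      moreover have "\<dots> \<le> K * inverse (real (Suc n))"
        using bd[of i] by (simp add: divide_inverse mult_right_mono)
      ultimately show ?thesis by simp
    qed
    then have "1 - K * inverse (real (Suc n)) \<le> measure L {b\<in>space L. \<forall>\<^sub>F i in U. \<bar>g i (pt b i)\<bar> \<le> real (Suc n)}"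
      by (intro tendsto_lowerbound[OF tendsto_measure_eventually _ U_nonbot]) auto
    also have "\<dots> \<le> measure L {b\<in>space L. fin g b}"
      by (intro L.finite_measure_mono measurable_fin im) (auto intro: finI)
    finally show ?thesis .
  qed
  moreover have "(\<lambda>n. 1 - K * inverse (real (Suc n))) \<longlonglongrightarrow> 1 - K * 0"
    by (intro tendsto_intros LIMSEQ_inverse_real_of_nat)
  ultimately have "1 \<le> measure L {b\<in>space L. fin g b}"
    using LIMSEQ_le_const2[of "\<lambda>n. 1 - K * inverse (real (Suc n))" 1] by simp
  then have "measure L {b\<in>space L. fin g b} = 1"
    using L.prob_le_1 by (intro antisym)
  then show ?thesis
    by (subst (asm) L.prob_Collect_eq_1) (use measurable_fin[OF im] in simp_all)
qed

section \<open>Approximation by internal sets and lifting of measurable functions\<close>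

text \<open>Induction over the generated sigma-algebra. The only real case is a countable union: it
  need not be internal, but it can be enclosed in an internal set of the same Loeb measure.\<close>

lemma sets_L_internal:
  assumes "S \<in> sets L"
  shows "\<exists>A. imeasurable A \<and> (AE b in L. b \<in> S \<longleftrightarrow> b \<in> internal A)"
  using assms unfolding sets_L
proof induction
  case (Basic a)
  then show ?case by (auto simp: internals_def)
next
  case Empty
  then show ?case
    by (intro exI[of _ "\<lambda>i. {}"]) (simp add: imeasurable_def internal_empty)
next
  case (Compl a)
  then obtain A where A: "imeasurable A" and eq: "AE b in L. b \<in> a \<longleftrightarrow> b \<in> internal A" by blast
  have "AE b in L. b \<in> \<Omega> - a \<longleftrightarrow> b \<in> internal (\<lambda>i. space (P i) - A i)"
    using eq AE_space
  proof eventually_elim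
    case (elim b)
    then show ?case by (simp add: internal_Diff \<Omega>_def space_L)
  qed
  moreover have "imeasurable (\<lambda>i. space (P i) - A i)" using A by (auto simp: imeasurable_def)
  ultimately show ?case by blast
next
  case (Union a)
  then have "\<forall>n. \<exists>A. imeasurable A \<and> (AE b in L. b \<in> a n \<longleftrightarrow> b \<in> internal A)" by blast
  then obtain A where A: "\<And>n. imeasurable (A n)"
    and eq: "\<And>n. AE b in L. b \<in> a n \<longleftrightarrow> b \<in> internal (A n)" by metis
  define B where "B m i = (\<Union>n<m. A n i)" for m i
  have B: "imeasurable (B m)" for m
    unfolding imeasurable_def B_def using A by (auto simp: imeasurable_def)
  have int_B: "internal (B m) = (\<Union>n<m. internal (A n))" for m
    unfolding B_def by (rule internal_UN) simp
  define V where "V = (\<Union>n. internal (A n))"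
  have V [measurable]: "V \<in> sets L" unfolding V_def using A by (intro sets.countable_UN) auto
  have "\<forall>\<^sub>F i in U. measure (P i) (B m i) < measure L V + inverse (real (Suc m))" for m
  proof (rule order_tendstoD(2)[OF tendsto_measure_internal[OF B]])
    have "measure L (internal (B m)) \<le> measure L V"
      unfolding int_B V_def by (intro L.finite_measure_mono) (use V V_def in auto)
    moreover have "0 < inverse (real (Suc m))" by simp
    ultimately show "measure L (internal (B m)) < measure L V + inverse (real (Suc m))"
      by linarith
  qed
  then obtain s
    where s: "\<And>i m. m < s i \<Longrightarrow> measure (P i) (B m i) < measure L V + inverse (real (Suc m))"
      and s_inf: "\<And>m. \<forall>\<^sub>F i in U. m \<le> s i"
    by (rule diagonal[of "\<lambda>m i. measure (P i) (B m i) < measure L V + inverse (real (Suc m))"]) blast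
  \<comment> \<open>A diagonal choice: one internal set of no larger measure contains all the internal sets.\<close>
  define D where "D i = B (s i - 1) i" for i
  have D: "imeasurable D" using B by (simp add: D_def imeasurable_def)
  have "V \<subseteq> internal D"
  proof -
    have "internal (A n) \<subseteq> internal D" for n
      unfolding internal_subset_iff using s_inf[of "Suc (Suc n)"]
    proof eventually_elim
      case (elim i)
      then have "n < s i - 1" by linarith
      then show ?case by (auto simp: D_def B_def)
    qed
    then show ?thesis by (auto simp: V_def)
  qed
  moreover have "measure L (internal D) \<le> measure L V"
  proof -
    have "measure L (internal D) \<le> measure L V + inverse (real (Suc m))" for m
    proof (rule tendsto_upperbound[OF tendsto_measure_internal[OF D] _ U_nonbot])
      show "\<forall>\<^sub>F i in U. measure (P i) (D i) \<le> measure L V + inverse (real (Suc m))"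
        using s_inf[of "Suc m"]
      proof eventually_elim
        case (elim i)
        then have "measure (P i) (D i) < measure L V + inverse (real (Suc (s i - 1)))"
          unfolding D_def by (intro s) linarith
        also have "inverse (real (Suc (s i - 1))) \<le> inverse (real (Suc m))"
          using elim by (intro le_imp_inverse_le) auto
        finally show ?case by simp
      qed
    qed
    moreover have "(\<lambda>m. measure L V + inverse (real (Suc m))) \<longlonglongrightarrow> measure L V + 0"
      by (intro tendsto_intros LIMSEQ_inverse_real_of_nat)
    ultimately show ?thesis using LIMSEQ_le_const[of _ "measure L V + 0"] by auto
  qed
  ultimately have "measure L (internal D - V) = 0"
    using L.finite_measure_Diff[of "internal D" V] D internal_sets measure_nonneg[of L "internal D - V"]
    by auto
  then have "AE b in L. b \<notin> internal D - V"
    using D by (intro AE_not_in) (auto simp: null_sets_def L.emeasure_eq_measure)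
  moreover have "AE b in L. \<forall>n. b \<in> a n \<longleftrightarrow> b \<in> internal (A n)"
    using eq by (simp add: AE_all_countable)
  ultimately have "AE b in L. b \<in> (\<Union>n. a n) \<longleftrightarrow> b \<in> internal D"
  proof eventually_elim
    case (elim b)
    then show ?case using \<open>V \<subseteq> internal D\<close> by (auto simp: V_def)
  qed
  with D show ?case by blast
qed

text \<open>The lift copies the binary digits of the function, which are indicators of measurable sets.\<close>
lemma lift_unit_interval:
  assumes [measurable]: "f \<in> borel_measurable L"
    and f01: "\<And>b. b \<in> space L \<Longrightarrow> 0 \<le> f b \<and> f b < 1"
  obtains v where "ifun v" "AE b in L. ((\<lambda>i. v i (pt b i)) \<longlongrightarrow> f b) U"
proof -
  define S where "S j = {b\<in>space L. odd \<lfloor>2 ^ Suc j * f b\<rfloor>}" for j :: nat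
  have "S j \<in> sets L" for j unfolding S_def by measurable
  then have "\<forall>j. \<exists>A. imeasurable A \<and> (AE b in L. b \<in> S j \<longleftrightarrow> b \<in> internal A)"
    using sets_L_internal by blast
  then obtain A where A: "\<And>j. imeasurable (A j)"
    and eq: "\<And>j. AE b in L. b \<in> S j \<longleftrightarrow> b \<in> internal (A j)" by metis
  \<comment> \<open>Stage \<open>i\<close> uses only its first \<open>i\<close> digits, so each
    stage is a finite sum; the number of digits tends to infinity along U.\<close>
  define v where "v i x = (\<Sum>j<i. (1/2 :: real) ^ Suc j * indicator (A j i) x)" for i x
  have "ifun v"
    unfolding ifun_def v_def using A
    by (intro allI borel_measurable_sum borel_measurable_times borel_measurable_indicator) (auto simp: imeasurable_def)
  moreover have "AE b in L. \<forall>j. b \<in> S j \<longleftrightarrow> b \<in> internal (A j)"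
    using eq by (simp add: AE_all_countable)
  then have "AE b in L. ((\<lambda>i. v i (pt b i)) \<longlongrightarrow> f b) U"
    using AE_space
  proof eventually_elim
    case (elim b)
    show ?case
    proof (rule tendstoI)
      fix e :: real assume "0 < e"
      then have "0 < e / 2" by simp
      \<comment> \<open>Two errors are each at most \<open>(1/2) ^ J\<close>: the digits of
        \<open>f b\<close> beyond \<open>J\<close>, and the later terms of \<open>v i\<close>, whose
        digits may be unrelated to those of \<open>f b\<close>.\<close>
      then obtain J where J: "(1/2 :: real) ^ J < e / 2"
        using real_arch_pow_inv[of "e/2" "1/2"] by auto
      have "\<forall>\<^sub>F i in U. \<forall>j\<in>{..<J}. indicator (A j i) (pt b i) = (of_bool (b \<in> S j) :: real)"
      proof (intro eventually_ball_finite ballI)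
        fix j
        show "\<forall>\<^sub>F i in U. indicator (A j i) (pt b i) = (of_bool (b \<in> S j) :: real)"
        proof (cases "b \<in> S j")
          case True
          then have "\<forall>\<^sub>F i in U. pt b i \<in> A j i" using elim by (simp add: internal_def)
          then show ?thesis using True by (auto elim: eventually_mono)
        next
          case False
          then have "\<forall>\<^sub>F i in U. pt b i \<notin> A j i" using elim by (simp add: internal_def not_U)
          then show ?thesis using False by (auto elim: eventually_mono)
        qed
      qed simp
      moreover have "\<forall>\<^sub>F i in U. J \<le> i" by (rule U_seq) (rule eventually_ge_at_top)
      ultimately show "\<forall>\<^sub>F i in U. dist (v i (pt b i)) (f b) < e"
      proof eventually_elim
        case (elim i)
        define t where "t j = (1/2 :: real) ^ Suc j * indicator (A j i) (pt b i)" for j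
        have "(\<Sum>j<J. t j) = (\<Sum>j<J. (1/2 :: real) ^ Suc j * of_bool (odd \<lfloor>2 ^ Suc j * f b\<rfloor>))"
          using elim \<open>b \<in> space L\<close> by (intro sum.cong) (auto simp: t_def S_def)
        also have "\<dots> = of_int \<lfloor>2 ^ J * f b\<rfloor> / 2 ^ J"
          using f01[OF \<open>b \<in> space L\<close>] by (intro binary_digit_sum) auto
        finally have "(\<Sum>j<J. t j) * 2 ^ J = of_int \<lfloor>2 ^ J * f b\<rfloor>" by simp
        moreover have "of_int \<lfloor>2 ^ J * f b\<rfloor> \<le> f b * 2 ^ J" "f b * 2 ^ J < of_int \<lfloor>2 ^ J * f b\<rfloor> + 1"
          by (simp_all add: mult.commute)
        ultimately have "\<bar>((\<Sum>j<J. t j) - f b) * 2 ^ J\<bar> \<le> 1" by (simp add: algebra_simps)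
        then have "\<bar>(\<Sum>j<J. t j) - f b\<bar> * 2 ^ J \<le> 1"
          by (simp only: abs_mult power_abs abs_numeral)
        then have 1: "\<bar>(\<Sum>j<J. t j) - f b\<bar> \<le> (1/2) ^ J"
          by (simp add: power_one_over pos_le_divide_eq)
        have "v i (pt b i) = (\<Sum>j<i. t j)" by (simp add: v_def t_def)
        then have "v i (pt b i) = (\<Sum>j<J. t j) + (\<Sum>j=J..<i. t j)"
          using sum.atLeastLessThan_concat[of 0 J i t] \<open>J \<le> i\<close> by (simp add: lessThan_atLeast0)
        moreover have "0 \<le> (\<Sum>j=J..<i. t j)" by (intro sum_nonneg) (simp add: t_def)
        moreover have "(\<Sum>j=J..<i. t j) \<le> (\<Sum>j=J..<i. (1/2) ^ Suc j)"
          by (intro sum_mono) (simp add: t_def indicator_def)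
        moreover have "(\<Sum>j=J..<i. (1/2 :: real) ^ Suc j) = (1/2) ^ J - (1/2) ^ i"
          using \<open>J \<le> i\<close> by (induction rule: dec_induct) simp_all
        moreover have "0 < (1/2 :: real) ^ i" by simp
        ultimately show ?case using 1 J unfolding dist_real_def by linarith
      qed
    qed
  qed
  ultimately show ?thesis by (rule that)
qed

lemma lift_bounded:
  assumes [measurable]: "f \<in> borel_measurable L" and bd: "AE b in L. \<bar>f b\<bar> \<le> C" and C: "0 < C"
  obtains v where "ifun v" "\<And>i x. \<bar>v i x\<bar> \<le> C" "AE b in L. ((\<lambda>i. v i (pt b i)) \<longlongrightarrow> f b) U"
proof -
  define clip where "clip y = max (- C) (min C y)" for y :: real
  \<comment> \<open>Dividing by \<open>2 * C + 1\<close> rather than \<open>2 * C\<close> keeps the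
    range strictly below 1, as the digit expansion requires.\<close>
  define g where "g b = (clip (f b) + C) / (2 * C + 1)" for b
  have [measurable]: "g \<in> borel_measurable L" unfolding g_def clip_def by measurable
  obtain u where u: "ifun u" "AE b in L. ((\<lambda>i. u i (pt b i)) \<longlongrightarrow> g b) U"
    by (rule lift_unit_interval[of g]) (use C in \<open>auto simp: g_def clip_def field_simps\<close>)
  \<comment> \<open>The outer \<open>clip\<close> forces the bound at every index and every point;
    it is continuous and fixes \<open>f b\<close> almost everywhere, so the limit is
    unaffected.\<close>
  define v where "v i x = clip ((2 * C + 1) * u i x - C)" for i x
  show ?thesis
  proof
    have [measurable]: "u i \<in> borel_measurable (P i)" for i using u(1) by (simp add: ifun_def)
    show "ifun v" unfolding ifun_def v_def clip_def by measurable
    show "\<bar>v i x\<bar> \<le> C" for i x using C by (simp add: v_def clip_def)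
    show "AE b in L. ((\<lambda>i. v i (pt b i)) \<longlongrightarrow> f b) U"
      using u(2) bd
    proof eventually_elim
      case (elim b)
      have "((\<lambda>i. v i (pt b i)) \<longlongrightarrow> clip ((2 * C + 1) * g b - C)) U"
        unfolding v_def clip_def by (intro tendsto_intros elim)
      moreover have "clip ((2 * C + 1) * g b - C) = f b"
        using elim C by (simp add: g_def clip_def)
      ultimately show ?case by simp
    qed
  qed
qed

section \<open>Convergence of integrals\<close>

text \<open>With a value set independent of \<open>i\<close>, the value at a point is constant along
  U, so the standard part is a simple function whose level sets are the internal level sets.\<close>

lemma integral_finite_valued:
  assumes f: "ifun f" and K: "finite K" and val: "\<And>i x. x \<in> space (P i) \<Longrightarrow> f i x \<in> K"
  shows "((\<lambda>i. \<integral>x. f i x \<partial>P i) \<longlongrightarrow> (\<integral>b. std f b \<partial>L)) U"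
proof -
  have [measurable]: "f i \<in> borel_measurable (P i)" for i using f by (simp add: ifun_def)
  define E where "E k i = {x\<in>space (P i). f i x = k}" for k i
  have [measurable]: "E k i \<in> sets (P i)" for k i unfolding E_def by measurable
  then have E: "imeasurable (E k)" for k by (simp add: imeasurable_def)
  have "(\<integral>x. f i x \<partial>P i) = (\<Sum>k\<in>K. k * measure (P i) (E k i))" for i
  proof -
    interpret prob_space "P i" by (rule prob_P)
    have "f i x = (\<Sum>k\<in>K. k * indicator (E k i) x)" if "x \<in> space (P i)" for x
      using val[OF that] K that by (simp add: E_def indicator_def sum.delta' if_distrib[of "\<lambda>y. _ * y"] of_bool_def cong: if_cong)
    then have "(\<integral>x. f i x \<partial>P i) = (\<integral>x. (\<Sum>k\<in>K. k * indicator (E k i) x) \<partial>P i)"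
      by (intro Bochner_Integration.integral_cong) auto
    also have "\<dots> = (\<Sum>k\<in>K. k * measure (P i) (E k i))"
      by (subst Bochner_Integration.integral_sum) (auto simp: emeasure_eq_measure)
    finally show ?thesis .
  qed
  moreover have "(\<integral>b. std f b \<partial>L) = (\<Sum>k\<in>K. k * measure L (internal (E k)))"
  proof -
    have "std f b = (\<Sum>k\<in>K. k * indicator (internal (E k)) b)" if b: "b \<in> space L" for b
    proof -
      have "\<forall>\<^sub>F i in U. \<exists>k\<in>K. f i (pt b i) = k"
        using b unfolding in_space_L by (rule eventually_mono) (simp add: val)
      from this[unfolded eventually_bex_finite[OF K]]
      obtain k where k: "k \<in> K" "\<forall>\<^sub>F i in U. f i (pt b i) = k" by blast
      have "std f b = k" by (rule std_eqI) (rule tendsto_eventually[OF k(2)])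
      moreover have "indicator (internal (E k')) b = (if k' = k then 1 else 0 :: real)" for k'
      proof (cases "k' = k")
        case True
        then show ?thesis using k(2) b
          by (auto simp: internal_def E_def in_space_L eventually_conj_iff indicator_def)
      next
        case False
        have "\<forall>\<^sub>F i in U. \<not> pt b i \<in> E k' i"
          using k(2) by eventually_elim (use False in \<open>auto simp: E_def\<close>)
        then show ?thesis using False by (simp add: internal_def flip: not_U)
      qed
      ultimately show ?thesis using K k(1) by (simp add: if_distrib[of "\<lambda>y. _ * y"] cong: if_cong)
    qed
    then have "(\<integral>b. std f b \<partial>L) = (\<integral>b. (\<Sum>k\<in>K. k * indicator (internal (E k)) b) \<partial>L)"
      by (intro Bochner_Integration.integral_cong) auto
    also have "\<dots> = (\<Sum>k\<in>K. k * measure L (internal (E k)))"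
      using internal_sets[OF E] internal_subset_space[OF E]
      by (subst Bochner_Integration.integral_sum) (auto simp: L.emeasure_eq_measure Int_absorb2)
    finally show ?thesis .
  qed
  moreover have "((\<lambda>i. \<Sum>k\<in>K. k * measure (P i) (E k i)) \<longlongrightarrow> (\<Sum>k\<in>K. k * measure L (internal (E k)))) U"
    by (intro tendsto_intros tendsto_measure_internal E)
  ultimately show ?thesis by simp
qed

text \<open>Rounding down to a grid of mesh \<open>1 / N\<close> reduces to finitely many values.
  The three thirds of \<open>e\<close> pay for rounding on \<open>P i\<close>, rounding on
  \<open>L\<close>, and convergence of the rounded integrals.\<close>

lemma integral_bounded:
  assumes f: "ifun f" and bd: "\<And>i x. x \<in> space (P i) \<Longrightarrow> \<bar>f i x\<bar> \<le> C"
  shows "((\<lambda>i. \<integral>x. f i x \<partial>P i) \<longlongrightarrow> (\<integral>b. std f b \<partial>L)) U"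
    and "integrable L (std f)"
proof -
  have [measurable]: "f i \<in> borel_measurable (P i)" for i using f by (simp add: ifun_def)
  have fin_f: "fin f b" if "b \<in> space L" for b
    using that unfolding in_space_L by (intro finI[where C=C]) (auto elim!: eventually_mono simp: bd)
  have int_f: "integrable (P i) (f i)" for i
  proof -
    interpret prob_space "P i" by (rule prob_P)
    show ?thesis by (rule integrable_const_bound[where B=C]) (auto simp: bd)
  qed
  have std_bd: "\<bar>std f b\<bar> \<le> C" if b: "b \<in> space L" for b
    using b unfolding in_space_L
    by (intro tendsto_upperbound[OF tendsto_rabs[OF tendsto_std[OF fin_f[OF b]]] _ U_nonbot])
       (auto elim!: eventually_mono simp: bd)
  show int_std: "integrable L (std f)"
    using measurable_std[OF f] by (intro L.integrable_const_bound[where B=C]) (auto simp: std_bd)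
  show "((\<lambda>i. \<integral>x. f i x \<partial>P i) \<longlongrightarrow> (\<integral>b. std f b \<partial>L)) U"
  proof (rule tendstoI)
    fix e :: real assume "0 < e"
    then obtain m :: nat where m: "inverse (real (Suc m)) < e / 3"
      using reals_Archimedean[of "e/3"] by auto
    define N where "N = real (Suc m)"
    have N: "0 < N" "1 / N < e / 3" using m by (auto simp: N_def inverse_eq_divide)
    define rnd where "rnd y = of_int \<lfloor>N * y\<rfloor> / N" for y :: real
    have rnd: "\<bar>y - rnd y\<bar> \<le> 1 / N" for y
    proof -
      have "\<bar>N * y - of_int \<lfloor>N * y\<rfloor>\<bar> \<le> 1" by linarith
      moreover have "y - rnd y = (N * y - of_int \<lfloor>N * y\<rfloor>) / N"
        using N by (simp add: rnd_def diff_divide_distrib)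
      ultimately show ?thesis using N by (simp add: divide_right_mono)
    qed
    have [measurable]: "rnd \<in> borel_measurable borel" unfolding rnd_def by measurable
    define g where "g i x = rnd (f i x)" for i x
    have g: "ifun g" unfolding ifun_def g_def by measurable
    have [measurable]: "g i \<in> borel_measurable (P i)" for i using g by (simp add: ifun_def)
    define K where "K = (\<lambda>k. of_int k / N) ` {\<lfloor>- N * C\<rfloor>..\<lfloor>N * C\<rfloor>}"
    have val: "g i x \<in> K" if "x \<in> space (P i)" for i x
    proof -
      have "f i x \<le> C" "- C \<le> f i x" using bd[OF that] by linarith+
      then have "N * f i x \<le> N * C" "- N * C \<le> N * f i x"
        using N mult_left_mono[of "f i x" C N] mult_left_mono[of "-C" "f i x" N] by auto
      then show ?thesis unfolding g_def rnd_def K_def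
        by (intro imageI) (auto intro: floor_mono)
    qed
    have K: "finite K" unfolding K_def by simp
    obtain C' where C': "\<And>k. k \<in> K \<Longrightarrow> \<bar>k\<bar> \<le> C'"
      using finite_imp_bounded[OF K] by (auto simp: bounded_iff)
    have fin_g: "fin g b" if "b \<in> space L" for b
      using that unfolding in_space_L by (intro finI[where C=C']) (auto elim!: eventually_mono intro: C' val)
    have close: "\<bar>std f b - std g b\<bar> \<le> 1 / N" if b: "b \<in> space L" for b
      by (rule tendsto_upperbound[OF tendsto_rabs[OF tendsto_diff[OF tendsto_std[OF fin_f[OF b]] tendsto_std[OF fin_g[OF b]]]] _ U_nonbot])
         (simp add: g_def rnd)
    have "\<bar>std g b\<bar> \<le> C + 1 / N" if "b \<in> space L" for b
      using close[OF that] std_bd[OF that] by linarith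
    then have int_g: "integrable L (std g)"
      using measurable_std[OF g] by (intro L.integrable_const_bound[where B="C + 1 / N"]) auto
    have "\<bar>(\<integral>b. std f b \<partial>L) - (\<integral>b. std g b \<partial>L)\<bar> \<le> (\<integral>b. 1 / N \<partial>L)"
      unfolding Bochner_Integration.integral_diff[OF int_std int_g, symmetric]
      by (rule order_trans[OF integral_abs_bound])
         (intro integral_mono integrable_abs Bochner_Integration.integrable_diff int_std int_g, auto simp: close)
    then have 1: "\<bar>(\<integral>b. std f b \<partial>L) - (\<integral>b. std g b \<partial>L)\<bar> \<le> 1 / N"
      by (simp add: L.prob_space)
    have 2: "\<bar>(\<integral>x. f i x \<partial>P i) - (\<integral>x. g i x \<partial>P i)\<bar> \<le> 1 / N" for i
    proof -
      interpret prob_space "P i" by (rule prob_P)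
      have int_gi: "integrable (P i) (g i)"
        by (rule integrable_const_bound[where B=C']) (auto intro: C' val)
      have "\<bar>(\<integral>x. f i x \<partial>P i) - (\<integral>x. g i x \<partial>P i)\<bar> \<le> (\<integral>x. 1 / N \<partial>P i)"
        unfolding Bochner_Integration.integral_diff[OF int_f int_gi, symmetric]
        by (rule order_trans[OF integral_abs_bound])
           (intro integral_mono integrable_abs Bochner_Integration.integrable_diff int_f int_gi, auto simp: g_def rnd)
      then show ?thesis by (simp add: prob_space)
    qed
    have "\<forall>\<^sub>F i in U. dist (\<integral>x. g i x \<partial>P i) (\<integral>b. std g b \<partial>L) < e / 3"
      by (rule tendstoD[OF integral_finite_valued[OF g K val]]) (use \<open>0 < e\<close> in simp_all)
    then show "\<forall>\<^sub>F i in U. dist (\<integral>x. f i x \<partial>P i) (\<integral>b. std f b \<partial>L) < e"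
    proof eventually_elim
      case (elim i)
      then show ?case using 1 2[of i] N(2) unfolding dist_real_def by linarith
    qed
  qed
qed

text \<open>A Fatou inequality: truncate, use the bounded case, and let the truncation level grow by
  monotone convergence. A first-moment bound alone cannot give equality, since mass may concentrate
  on sets whose measure tends to 0.\<close>

lemma integral_std_le:
  assumes g: "\<And>i. integrable (P i) (g i)" and bd: "\<And>i. (\<integral>x. \<bar>g i x\<bar> \<partial>P i) \<le> K"
  shows "integrable L (std g)" and "(\<integral>b. \<bar>std g b\<bar> \<partial>L) \<le> K"
proof -
  have im: "ifun g" using g by (auto simp: ifun_def)
  then have [measurable]: "g i \<in> borel_measurable (P i)" for i by (simp add: ifun_def)
  have [measurable]: "std g \<in> borel_measurable L" using im by (rule measurable_std)
  define h where "h n b = min (real n) \<bar>std g b\<bar>" for n b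
  have [measurable]: "h n \<in> borel_measurable L" for n unfolding h_def by measurable
  have int_h: "integrable L (h n)" for n
    by (rule L.integrable_const_bound[where B="real n"]) (auto simp: h_def)
  have h_le: "(\<integral>b. h n b \<partial>L) \<le> K" for n
  proof -
    define f where "f i x = min (real n) \<bar>g i x\<bar>" for i x
    have f: "ifun f" unfolding ifun_def f_def by measurable
    \<comment> \<open>Only almost everywhere: at points where the sequence is unbounded
      \<open>std g b\<close> is the default 0, whereas the truncated sequence still has its own
      limit.\<close>
    have "AE b in L. h n b = std f b"
      using AE_fin[OF g bd]
    proof eventually_elim
      case (elim b)
      then show ?case unfolding h_def f_def
        by (intro std_eqI[symmetric] tendsto_intros tendsto_std)
    qed
    then have "(\<integral>b. h n b \<partial>L) = (\<integral>b. std f b \<partial>L)"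
      using measurable_std[OF f] by (intro integral_cong_AE) auto
    also have "\<dots> \<le> K"
    proof (rule tendsto_upperbound[OF integral_bounded(1)[OF f] _ U_nonbot])
      show "\<bar>f i x\<bar> \<le> real n" for i x by (simp add: f_def)
      have "(\<integral>x. f i x \<partial>P i) \<le> K" for i
      proof -
        interpret prob_space "P i" by (rule prob_P)
        have "integrable (P i) (f i)"
          using f by (intro integrable_const_bound[where B="real n"]) (auto simp: f_def ifun_def)
        then have "(\<integral>x. f i x \<partial>P i) \<le> (\<integral>x. \<bar>g i x\<bar> \<partial>P i)"
          using g by (intro integral_mono integrable_abs) (auto simp: f_def)
        then show ?thesis using bd[of i] by simp
      qed
      then show "\<forall>\<^sub>F i in U. (\<integral>x. f i x \<partial>P i) \<le> K" by simp
    qed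
    finally show ?thesis .
  qed
  have inc: "incseq (\<lambda>n. \<integral>b. h n b \<partial>L)"
    by (intro incseq_SucI integral_mono int_h) (simp add: h_def)
  obtain l where l: "(\<lambda>n. \<integral>b. h n b \<partial>L) \<longlonglongrightarrow> l"
    by (rule incseq_convergent[OF inc]) (use h_le in auto)
  have mono: "AE b in L. mono (\<lambda>n. h n b)" by (auto simp: h_def mono_def)
  have lim: "AE b in L. (\<lambda>n. h n b) \<longlonglongrightarrow> \<bar>std g b\<bar>"
  proof (intro AE_I2 tendsto_eventually)
    fix b
    obtain N :: nat where "\<bar>std g b\<bar> \<le> real N" using real_arch_simple by blast
    then have "h n b = \<bar>std g b\<bar>" if "N \<le> n" for n
      using that by (simp add: h_def)
    then show "\<forall>\<^sub>F n in sequentially. h n b = \<bar>std g b\<bar>"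
      by (auto simp: eventually_sequentially)
  qed
  have "integrable L (\<lambda>b. \<bar>std g b\<bar>)" "(\<integral>b. \<bar>std g b\<bar> \<partial>L) = l"
    by (rule integrable_monotone_convergence[OF int_h mono lim l], measurable)
       (rule integral_monotone_convergence[OF int_h mono lim l], measurable)
  then show "integrable L (std g)" "(\<integral>b. \<bar>std g b\<bar> \<partial>L) \<le> K"
    using LIMSEQ_le_const2[OF l] h_le by (auto intro: integrable_abs_iff[THEN iffD1])
qed

text \<open>Truncating at level \<open>R\<close> costs at most \<open>K * R powr (1 - q)\<close> in
  mean at every index, and by the Fatou inequality also on \<open>L\<close>; the truncated integrals
  converge by the bounded case.\<close>

lemma integral_tendsto_powr_bounded:
  assumes q: "1 < q" and g: "ifun g" and int_q: "\<And>i. integrable (P i) (\<lambda>x. \<bar>g i x\<bar> powr q)"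
    and bd: "\<And>i. (\<integral>x. \<bar>g i x\<bar> powr q \<partial>P i) \<le> K"
  shows "((\<lambda>i. \<integral>x. g i x \<partial>P i) \<longlongrightarrow> (\<integral>b. std g b \<partial>L)) U" and "integrable L (std g)"
    and "AE b in L. fin g b"
proof -
  have [measurable]: "g i \<in> borel_measurable (P i)" for i using g by (simp add: ifun_def)
  have int_g: "integrable (P i) (g i)" for i
  proof -
    interpret prob_space "P i" by (rule prob_P)
    show ?thesis
      by (rule Bochner_Integration.integrable_bound[of _ "\<lambda>x. 1 + \<bar>g i x\<bar> powr q"])
         (use int_q[of i] order_trans[OF le_one_plus_powr[OF q] abs_ge_self] in auto)
  qed
  have bd1: "(\<integral>x. \<bar>g i x\<bar> \<partial>P i) \<le> 1 + K" for i
  proof -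
    interpret prob_space "P i" by (rule prob_P)
    have "(\<integral>x. \<bar>g i x\<bar> \<partial>P i) \<le> (\<integral>x. 1 + \<bar>g i x\<bar> powr q \<partial>P i)"
      using int_g int_q[of i] by (intro integral_mono le_one_plus_powr[OF q]) auto
    also have "\<dots> = 1 + (\<integral>x. \<bar>g i x\<bar> powr q \<partial>P i)"
      using int_q[of i] by (simp add: prob_space)
    finally show ?thesis using bd[of i] by simp
  qed
  show fin_g: "AE b in L. fin g b" by (rule AE_fin[OF int_g bd1])
  show int_std: "integrable L (std g)" by (rule integral_std_le(1)[OF int_g bd1])
  show "((\<lambda>i. \<integral>x. g i x \<partial>P i) \<longlongrightarrow> (\<integral>b. std g b \<partial>L)) U"
  proof (rule tendstoI)
    fix e :: real assume "0 < e"
    have "(\<lambda>n. K * real n powr (1 - q)) \<longlonglongrightarrow> K * 0"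
      using q by (intro tendsto_intros tendsto_neg_powr filterlim_real_sequentially) auto
    then have "\<forall>\<^sub>F n in sequentially. K * real n powr (1 - q) < e / 3"
      using \<open>0 < e\<close> by (intro order_tendstoD) auto
    then have "\<forall>\<^sub>F n in sequentially. 0 < n \<and> K * real n powr (1 - q) < e / 3"
      using eventually_gt_at_top[of "0::nat"] by eventually_elim auto
    then obtain n where n: "0 < n" "K * real n powr (1 - q) < e / 3"
      by (auto dest: eventually_happens'[OF sequentially_bot])
    define R where "R = real n"
    have R: "0 < R" "K * R powr (1 - q) < e / 3" using n by (auto simp: R_def)
    define f where "f i x = max (- R) (min R (g i x))" for i x
    have f: "ifun f" unfolding ifun_def f_def by measurable
    then have [measurable]: "f i \<in> borel_measurable (P i)" for i by (simp add: ifun_def)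
    have f_bd: "\<bar>f i x\<bar> \<le> R" for i x using R by (auto simp: f_def)
    have int_f: "integrable (P i) (f i)" for i
    proof -
      interpret prob_space "P i" by (rule prob_P)
      show ?thesis by (rule integrable_const_bound[where B=R]) (auto simp: f_bd)
    qed
    have int_d: "integrable (P i) (\<lambda>x. g i x - f i x)" for i
      using int_g int_f by simp
    have d_bd: "(\<integral>x. \<bar>g i x - f i x\<bar> \<partial>P i) \<le> K * R powr (1 - q)" for i
    proof -
      have "(\<integral>x. \<bar>g i x - f i x\<bar> \<partial>P i) \<le> (\<integral>x. \<bar>g i x\<bar> powr q * R powr (1 - q) \<partial>P i)"
        unfolding f_def using int_d[of i] int_q[of i]
        by (intro integral_mono truncation_error R q integrable_abs) (auto simp: f_def)
      also have "\<dots> = (\<integral>x. \<bar>g i x\<bar> powr q \<partial>P i) * R powr (1 - q)" by simp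
      also have "\<dots> \<le> K * R powr (1 - q)" using bd[of i] by (rule mult_right_mono) simp
      finally show ?thesis .
    qed
    \<comment> \<open>Rewriting the difference of standard parts as one standard part lets
      \<open>integral_std_le\<close> bound the truncation error on \<open>L\<close>.\<close>
    have "AE b in L. std (\<lambda>i x. g i x - f i x) b = std g b - std f b"
      using fin_g
    proof eventually_elim
      case (elim b)
      have "fin f b" by (rule finI[where C=R]) (simp add: f_bd)
      then show ?case using elim by (intro std_eqI tendsto_diff tendsto_std)
    qed
    then have "(\<integral>b. std g b - std f b \<partial>L) = (\<integral>b. std (\<lambda>i x. g i x - f i x) b \<partial>L)"
      using g f by (intro integral_cong_AE) (auto simp: ifun_def)
    then have 1: "\<bar>(\<integral>b. std g b \<partial>L) - (\<integral>b. std f b \<partial>L)\<bar> \<le> K * R powr (1 - q)"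
      using order_trans[OF integral_abs_bound integral_std_le(2)[OF int_d d_bd]]
        int_std integral_bounded(2)[OF f f_bd] by simp
    have 2: "\<bar>(\<integral>x. g i x \<partial>P i) - (\<integral>x. f i x \<partial>P i)\<bar> \<le> K * R powr (1 - q)" for i
      using d_bd[of i] integral_abs_bound[of "P i" "\<lambda>x. g i x - f i x"] int_g int_f by simp
    have "\<forall>\<^sub>F i in U. dist (\<integral>x. f i x \<partial>P i) (\<integral>b. std f b \<partial>L) < e / 3"
      by (rule tendstoD[OF integral_bounded(1)[OF f f_bd]]) (use \<open>0 < e\<close> in simp)
    then show "\<forall>\<^sub>F i in U. dist (\<integral>x. g i x \<partial>P i) (\<integral>b. std g b \<partial>L) < e"
    proof eventually_elim
      case (elim i)
      then show ?case using 1 2[of i] R(2) unfolding dist_real_def by linarith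
    qed
  qed
qed

end

section \<open>The Levy--Prokhorov and Hausdorff distances\<close>

lemma dist_fin_eq_L2_set: "dist_fin n x y = L2_set (\<lambda>i. x i - y i) {..<n}"
  by (simp add: dist_fin_def L2_set_def)

lemma dist_fin_commute: "dist_fin n x y = dist_fin n y x"
  by (simp add: dist_fin_def power2_commute)

lemma dist_fin_triangle: "dist_fin n x z \<le> dist_fin n x y + dist_fin n y z"
  using L2_set_triangle_ineq[of "\<lambda>i. x i - y i" "\<lambda>i. y i - z i" "{..<n}"]
  by (simp add: dist_fin_eq_L2_set)

lemma dist_fin_le:
  assumes "\<And>i. i < n \<Longrightarrow> \<bar>x i - y i\<bar> \<le> d"
  shows "dist_fin n x y \<le> real n * d"
proof -
  have "dist_fin n x y \<le> (\<Sum>i<n. \<bar>x i - y i\<bar>)"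
    unfolding dist_fin_eq_L2_set by (rule L2_set_le_sum_abs)
  also have "\<dots> \<le> (\<Sum>i<n. d)" by (rule sum_mono) (use assms in auto)
  finally show ?thesis by simp
qed

lemma dist_fin_measurable [measurable]:
  "(\<lambda>y. dist_fin n r y) \<in> borel_measurable (Rspace n)"
  unfolding dist_fin_def Rspace_def by measurable

lemma rational_vector_near:
  assumes "0 < e"
  obtains r where "r \<in> {..<n} \<rightarrow>\<^sub>E \<rat>" "dist_fin n r y < e"
proof -
  define d where "d = e / (real n + 1)"
  have d: "0 < d" using assms by (simp add: d_def)
  have "\<exists>q\<in>\<rat>. y i < q \<and> q < y i + d" for i
    using Rats_dense_in_real[of "y i" "y i + d"] d by auto
  then obtain r where r: "\<And>i. r i \<in> \<rat>" "\<And>i. y i < r i" "\<And>i. r i < y i + d" by metis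
  show ?thesis
  proof
    show "restrict r {..<n} \<in> {..<n} \<rightarrow>\<^sub>E \<rat>" using r by auto
    have "dist_fin n (restrict r {..<n}) y \<le> real n * d"
    proof (rule dist_fin_le)
      fix i assume "i < n"
      then show "\<bar>restrict r {..<n} i - y i\<bar> \<le> d" using r(2)[of i] r(3)[of i] by simp
    qed
    also have "\<dots> < e" using assms by (simp add: d_def field_simps)
    finally show "dist_fin n (restrict r {..<n}) y < e" .
  qed
qed

text \<open>The neighbourhood of an arbitrary set is the union of the balls with rational centre and
  radius that it contains. Measurability matters because the measure of a nonmeasurable set defaults
  to 0, which would spoil monotonicity arguments.\<close>

lemma nbhd_measurable [measurable]: "nbhd n V e \<in> sets (Rspace n)"
proof -
  define B where "B r s = {y\<in>space (Rspace n). dist_fin n r y < s}" for r s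
  define C where "C = {(r, s). r \<in> ({..<n} \<rightarrow>\<^sub>E \<rat>) \<and> s \<in> \<rat> \<and> B r s \<subseteq> nbhd n V e}"
  have "nbhd n V e = (\<Union>(r, s)\<in>C. B r s)"
  proof (intro equalityI subsetI)
    fix y assume "y \<in> nbhd n V e"
    then obtain x where y: "y \<in> space (Rspace n)" and x: "x \<in> V" "dist_fin n x y < e"
      by (auto simp: nbhd_def)
    \<comment> \<open>Half of the room left at \<open>y\<close>: a ball of radius below
      \<open>\<eta>\<close> whose centre is within \<open>\<eta>\<close> of \<open>y\<close> stays
      inside the neighbourhood.\<close>
    define \<eta> where "\<eta> = (e - dist_fin n x y) / 2"
    have "0 < \<eta>" using x by (simp add: \<eta>_def)
    obtain r where r: "r \<in> {..<n} \<rightarrow>\<^sub>E \<rat>" "dist_fin n r y < \<eta>"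
      by (rule rational_vector_near[OF \<open>0 < \<eta>\<close>])
    obtain s where s: "s \<in> \<rat>" "dist_fin n r y < s" "s < \<eta>"
      using Rats_dense_in_real[OF r(2)] by auto
    have "B r s \<subseteq> nbhd n V e"
    proof
      fix z assume z: "z \<in> B r s"
      have "dist_fin n x z \<le> dist_fin n x y + dist_fin n y r + dist_fin n r z"
        using dist_fin_triangle[of n x z y] dist_fin_triangle[of n y z r] by linarith
      also have "\<dots> < dist_fin n x y + \<eta> + \<eta>"
        using r s z dist_fin_commute[of n y r] by (auto simp: B_def)
      finally have "dist_fin n x z < e" by (simp add: \<eta>_def)
      then show "z \<in> nbhd n V e" using z x by (auto simp: B_def nbhd_def)
    qed
    then show "y \<in> (\<Union>(r, s)\<in>C. B r s)" using r s y by (auto simp: C_def B_def)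
  qed (auto simp: C_def)
  moreover have "countable C"
  proof (rule countable_subset)
    show "C \<subseteq> ({..<n} \<rightarrow>\<^sub>E \<rat>) \<times> \<rat>" by (auto simp: C_def)
    show "countable (({..<n} \<rightarrow>\<^sub>E (\<rat> :: real set)) \<times> (\<rat> :: real set))"
      by (intro countable_SIGMA countable_PiE countable_rat) auto
  qed
  moreover have "B r s \<in> sets (Rspace n)" for r s unfolding B_def by measurable
  ultimately show ?thesis by (auto intro!: sets.countable_UN'' split: prod.splits)
qed

lemma nbhd_nbhd: "nbhd n (nbhd n V e) e' \<subseteq> nbhd n V (e + e')"
proof
  fix z assume "z \<in> nbhd n (nbhd n V e) e'"
  then obtain x y where "z \<in> space (Rspace n)" "x \<in> V" "dist_fin n x y < e" "dist_fin n y z < e'"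
    by (auto simp: nbhd_def)
  moreover from this have "dist_fin n x z < e + e'" using dist_fin_triangle[of n x z y] by linarith
  ultimately show "z \<in> nbhd n V (e + e')" by (auto simp: nbhd_def)
qed

lemma nbhd_mono: "e \<le> e' \<Longrightarrow> nbhd n V e \<subseteq> nbhd n V e'"
  unfolding nbhd_def by (blast intro: less_le_trans)

section \<open>The Levy--Prokhorov distance as a pseudometric on laws\<close>

definition Rprob :: "nat \<Rightarrow> (nat \<Rightarrow> real) measure set" where
  "Rprob n = {\<mu>. prob_space \<mu> \<and> sets \<mu> = sets (Rspace n)}"

definition LP_within :: "nat \<Rightarrow> (nat \<Rightarrow> real) measure \<Rightarrow> (nat \<Rightarrow> real) measure \<Rightarrow> real \<Rightarrow> bool" where
  "LP_within n \<mu> \<nu> e \<longleftrightarrow> e > 0 \<and> (\<forall>V\<in>sets (Rspace n). measure \<mu> V \<le> measure \<nu> (nbhd n V e) + e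
     \<and> measure \<nu> V \<le> measure \<mu> (nbhd n V e) + e)"

lemma LP_dist_eq: "LP_dist n \<mu> \<nu> = Inf {e. LP_within n \<mu> \<nu> e}"
  by (simp add: LP_dist_def LP_within_def)

lemma LP_dist_commute: "LP_dist n \<mu> \<nu> = LP_dist n \<nu> \<mu>"
proof -
  have "LP_within n \<mu> \<nu> = LP_within n \<nu> \<mu>" by (intro ext) (auto simp: LP_within_def)
  then show ?thesis by (simp add: LP_dist_eq)
qed

text \<open>Keeps the infimum in \<open>LP_dist\<close> from ranging over the empty set, and bounds
  all distances by 1.\<close>

lemma LP_within_1:
  assumes "\<mu> \<in> Rprob n" "\<nu> \<in> Rprob n"
  shows "LP_within n \<mu> \<nu> 1"
proof -
  have "measure \<rho> V \<le> measure \<sigma> V' + 1" if "\<rho> \<in> Rprob n" for \<rho> \<sigma> :: "(nat \<Rightarrow> real) measure" and V V'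
    using that by (simp add: Rprob_def add_increasing prob_space.prob_le_1)
  then show ?thesis using assms by (simp add: LP_within_def)
qed

lemma LP_within_bdd: "bdd_below {e. LP_within n \<mu> \<nu> e}"
  by (rule bdd_belowI[of _ 0]) (auto simp: LP_within_def)

lemma LP_dist_leI: "LP_within n \<mu> \<nu> e \<Longrightarrow> LP_dist n \<mu> \<nu> \<le> e"
  unfolding LP_dist_eq by (rule cInf_lower) (auto intro: LP_within_bdd)

lemma LP_dist_le_1: "\<mu> \<in> Rprob n \<Longrightarrow> \<nu> \<in> Rprob n \<Longrightarrow> LP_dist n \<mu> \<nu> \<le> 1"
  by (intro LP_dist_leI LP_within_1)

lemma LP_dist_nonneg: "\<mu> \<in> Rprob n \<Longrightarrow> \<nu> \<in> Rprob n \<Longrightarrow> 0 \<le> LP_dist n \<mu> \<nu>"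
  unfolding LP_dist_eq using LP_within_1[of \<mu> n \<nu>]
  by (intro cInf_greatest) (blast, simp add: LP_within_def)

lemma LP_dist_lessD:
  assumes "\<mu> \<in> Rprob n" "\<nu> \<in> Rprob n" "LP_dist n \<mu> \<nu> < a"
  shows "LP_within n \<mu> \<nu> a"
proof -
  obtain e where e: "LP_within n \<mu> \<nu> e" "e < a"
    using assms(3) LP_within_1[OF assms(1,2)] cInf_lessD[of "{e. LP_within n \<mu> \<nu> e}" a]
    by (auto simp: LP_dist_eq)
  have mono: "measure \<rho> (nbhd n V e) \<le> measure \<rho> (nbhd n V a)" if "\<rho> \<in> Rprob n" for \<rho> V
    using that e nbhd_measurable[of n V]
    by (intro finite_measure.finite_measure_mono nbhd_mono)
       (auto simp: Rprob_def prob_space_def)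
  show ?thesis
    unfolding LP_within_def
  proof (intro conjI ballI)
    show "0 < a" using e by (simp add: LP_within_def)
    fix V assume "V \<in> sets (Rspace n)"
    then have "measure \<mu> V \<le> measure \<nu> (nbhd n V e) + e" "measure \<nu> V \<le> measure \<mu> (nbhd n V e) + e"
      using e(1) by (auto simp: LP_within_def)
    then show "measure \<mu> V \<le> measure \<nu> (nbhd n V a) + a" "measure \<nu> V \<le> measure \<mu> (nbhd n V a) + a"
      using mono[OF assms(1), of V] mono[OF assms(2), of V] e(2) by linarith+
  qed
qed

lemma LP_dist_triangle:
  assumes "\<mu> \<in> Rprob n" "\<nu> \<in> Rprob n" "\<rho> \<in> Rprob n"
  shows "LP_dist n \<mu> \<rho> \<le> LP_dist n \<mu> \<nu> + LP_dist n \<nu> \<rho>"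
proof (rule field_le_epsilon)
  fix e :: real assume "0 < e"
  define a b where "a = LP_dist n \<mu> \<nu> + e / 2" and "b = LP_dist n \<nu> \<rho> + e / 2"
  have a: "LP_within n \<mu> \<nu> a" using assms \<open>0 < e\<close> by (intro LP_dist_lessD) (auto simp: a_def)
  have b: "LP_within n \<nu> \<rho> b" using assms \<open>0 < e\<close> by (intro LP_dist_lessD) (auto simp: b_def)
  have mono: "measure \<sigma> (nbhd n (nbhd n V c) d) \<le> measure \<sigma> (nbhd n V (c + d))"
    if "\<sigma> \<in> Rprob n" for \<sigma> V c d
    using that nbhd_measurable[of n V]
    by (intro finite_measure.finite_measure_mono nbhd_nbhd)
       (auto simp: Rprob_def prob_space_def)
  have "LP_within n \<mu> \<rho> (a + b)"
    unfolding LP_within_def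
  proof (intro conjI ballI)
    show "0 < a + b" using a b by (simp add: LP_within_def)
    fix V assume V: "V \<in> sets (Rspace n)"
    have "measure \<mu> V \<le> measure \<nu> (nbhd n V a) + a" using a V by (simp add: LP_within_def)
    also have "measure \<nu> (nbhd n V a) \<le> measure \<rho> (nbhd n (nbhd n V a) b) + b"
      using b nbhd_measurable by (simp add: LP_within_def)
    finally show "measure \<mu> V \<le> measure \<rho> (nbhd n V (a + b)) + (a + b)"
      using mono[OF assms(3), of V a b] by simp
    have "measure \<rho> V \<le> measure \<nu> (nbhd n V b) + b" using b V by (simp add: LP_within_def)
    also have "measure \<nu> (nbhd n V b) \<le> measure \<mu> (nbhd n (nbhd n V b) a) + a"
      using a nbhd_measurable by (simp add: LP_within_def)
    finally show "measure \<rho> V \<le> measure \<mu> (nbhd n V (a + b)) + (a + b)"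
      using mono[OF assms(1), of V b a] by (simp add: add.commute)
  qed
  then have "LP_dist n \<mu> \<rho> \<le> a + b" by (rule LP_dist_leI)
  then show "LP_dist n \<mu> \<rho> \<le> LP_dist n \<mu> \<nu> + LP_dist n \<nu> \<rho> + e" by (simp add: a_def b_def)
qed

section \<open>Comparing laws through matched cells\<close>

text \<open>Cells \<open>E j\<close> and \<open>E' j\<close> are matched. If \<open>E j\<close>
  meets the preimage of \<open>V\<close>, then all of \<open>E' j\<close> is mapped into the
  \<open>d\<close>-neighbourhood of \<open>V\<close>. Half of \<open>d\<close> pays for mass outside
  the cells, the other half for unequal masses of matched cells.\<close>

lemma coupling_one_sided:
  assumes M: "prob_space M" and N: "prob_space N"
    and X: "X \<in> measurable M (Rspace n)" and Y: "Y \<in> measurable N (Rspace n)"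
    and J: "finite J" and E: "\<And>j. j \<in> J \<Longrightarrow> E j \<in> sets M" and E': "\<And>j. j \<in> J \<Longrightarrow> E' j \<in> sets N"
    and disj: "disjoint_family_on E J" and disj': "disjoint_family_on E' J"
    and diff: "(\<Sum>j\<in>J. \<bar>measure M (E j) - measure N (E' j)\<bar>) \<le> d / 2"
    and mass: "1 - d / 2 \<le> (\<Sum>j\<in>J. measure M (E j))"
    and close: "\<And>j x y. j \<in> J \<Longrightarrow> x \<in> E j \<Longrightarrow> y \<in> E' j \<Longrightarrow> dist_fin n (X x) (Y y) < d"
    and V: "V \<in> sets (Rspace n)"
  shows "measure (distr M (Rspace n) X) V \<le> measure (distr N (Rspace n) Y) (nbhd n V d) + d"
proof -
  interpret M: prob_space M by (rule M)
  interpret N: prob_space N by (rule N)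
  let ?A = "X -` V \<inter> space M" and ?B = "Y -` nbhd n V d \<inter> space N"
  define I where "I = {j\<in>J. E j \<inter> ?A \<noteq> {}}"
  have I: "finite I" "I \<subseteq> J" using J by (auto simp: I_def)
  have A: "?A \<in> sets M" using X V by (rule measurable_sets)
  have B: "?B \<in> sets N" using Y nbhd_measurable by (rule measurable_sets)
  have UE: "(\<Union>j\<in>J. E j) \<in> sets M" and UI: "(\<Union>j\<in>I. E j) \<in> sets M" using J I E by auto
  have "?A \<subseteq> (\<Union>j\<in>I. E j) \<union> (space M - (\<Union>j\<in>J. E j))" by (auto simp: I_def)
  then have "M.prob ?A \<le> M.prob ((\<Union>j\<in>I. E j) \<union> (space M - (\<Union>j\<in>J. E j)))"
    using UE UI by (intro M.finite_measure_mono) auto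
  also have "\<dots> \<le> M.prob (\<Union>j\<in>I. E j) + M.prob (space M - (\<Union>j\<in>J. E j))"
    using UE UI by (intro measure_Un_le) auto
  also have "M.prob (\<Union>j\<in>I. E j) = (\<Sum>j\<in>I. M.prob (E j))"
    using I E disjoint_family_on_mono[OF I(2) disj] by (intro M.finite_measure_finite_Union) auto
  also have "M.prob (space M - (\<Union>j\<in>J. E j)) = 1 - (\<Sum>j\<in>J. M.prob (E j))"
    using M.prob_compl[OF UE] M.finite_measure_finite_Union[OF J _ disj] E by auto
  also have "(\<Sum>j\<in>I. M.prob (E j)) \<le> (\<Sum>j\<in>I. N.prob (E' j)) + (\<Sum>j\<in>I. \<bar>M.prob (E j) - N.prob (E' j)\<bar>)"
    unfolding sum.distrib[symmetric] by (intro sum_mono) linarith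
  also have "(\<Sum>j\<in>I. \<bar>M.prob (E j) - N.prob (E' j)\<bar>) \<le> (\<Sum>j\<in>J. \<bar>M.prob (E j) - N.prob (E' j)\<bar>)"
    using J I by (intro sum_mono2) auto
  also have "(\<Sum>j\<in>I. N.prob (E' j)) = N.prob (\<Union>j\<in>I. E' j)"
    using I E' disjoint_family_on_mono[OF I(2) disj'] by (intro N.finite_measure_finite_Union[symmetric]) auto
  also have "N.prob (\<Union>j\<in>I. E' j) \<le> N.prob ?B"
  proof (intro N.finite_measure_mono B subsetI)
    fix y assume "y \<in> (\<Union>j\<in>I. E' j)"
    then obtain j x where jx: "j \<in> J" "y \<in> E' j" "x \<in> E j" "X x \<in> V" by (auto simp: I_def)
    then have "y \<in> space N" using E'[OF jx(1)] sets.sets_into_space by blast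
    then have "Y y \<in> space (Rspace n)" using Y by (rule measurable_space[rotated])
    then show "y \<in> ?B" using jx close[OF jx(1,3,2)] \<open>y \<in> space N\<close> by (auto simp: nbhd_def)
  qed
  finally show ?thesis using diff mass X Y V nbhd_measurable by (simp add: measure_distr)
qed

text \<open>The budgets are \<open>d / 4\<close> because the reverse direction must also bound the
  mass outside the cells \<open>E' j\<close>, which costs both errors together.\<close>

lemma LP_dist_coupling:
  assumes M: "prob_space M" and N: "prob_space N"
    and X: "X \<in> measurable M (Rspace n)" and Y: "Y \<in> measurable N (Rspace n)"
    and J: "finite J" and E: "\<And>j. j \<in> J \<Longrightarrow> E j \<in> sets M" and E': "\<And>j. j \<in> J \<Longrightarrow> E' j \<in> sets N"
    and disj: "disjoint_family_on E J" and disj': "disjoint_family_on E' J"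
    and diff: "(\<Sum>j\<in>J. \<bar>measure M (E j) - measure N (E' j)\<bar>) \<le> d / 4"
    and mass: "1 - d / 4 \<le> (\<Sum>j\<in>J. measure M (E j))" and d: "0 < d"
    and close: "\<And>j x y. j \<in> J \<Longrightarrow> x \<in> E j \<Longrightarrow> y \<in> E' j \<Longrightarrow> dist_fin n (X x) (Y y) < d"
  shows "LP_dist n (distr M (Rspace n) X) (distr N (Rspace n) Y) \<le> d"
proof (rule LP_dist_leI, unfold LP_within_def, intro conjI ballI d)
  fix V assume V: "V \<in> sets (Rspace n)"
  show "measure (distr M (Rspace n) X) V \<le> measure (distr N (Rspace n) Y) (nbhd n V d) + d"
    using diff mass d by (intro coupling_one_sided[OF M N X Y J E E' disj disj' _ _ close V]) auto
  have "(\<Sum>j\<in>J. measure M (E j)) \<le> (\<Sum>j\<in>J. measure N (E' j) + \<bar>measure M (E j) - measure N (E' j)\<bar>)"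
    by (intro sum_mono) linarith
  then have "1 - d / 2 \<le> (\<Sum>j\<in>J. measure N (E' j))" using diff mass by (simp add: sum.distrib)
  moreover have "(\<Sum>j\<in>J. \<bar>measure N (E' j) - measure M (E j)\<bar>) \<le> d / 2"
    using diff d by (simp add: abs_minus_commute)
  ultimately show "measure (distr N (Rspace n) Y) V \<le> measure (distr M (Rspace n) X) (nbhd n V d) + d"
    by (intro coupling_one_sided[OF N M Y X J E' E disj' disj _ _ _ V])
       (use close dist_fin_commute in auto)
qed

section \<open>The Hausdorff distance between sets of laws\<close>

text \<open>Real-valued \<open>SUP\<close> and \<open>INF\<close> carry information only on bounded
  nonempty families; distances in the unit interval provide this, and strictness turns the infimum
  into an actual witness.\<close>

lemma hausdorff_LP_lessD:
  assumes X: "X \<subseteq> Rprob n" and Y: "Y \<subseteq> Rprob n" "Y \<noteq> {}"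
    and less: "hausdorff_LP n X Y < e" and \<mu>: "\<mu> \<in> X"
  obtains \<nu> where "\<nu> \<in> Y" "LP_dist n \<mu> \<nu> < e"
proof -
  have bdd: "bdd_below (LP_dist n \<mu>' ` Y)" if "\<mu>' \<in> X" for \<mu>'
    using that X Y by (intro bdd_belowI2[of _ 0]) (auto intro: LP_dist_nonneg)
  have "bdd_above ((\<lambda>\<mu>. INF \<nu>\<in>Y. LP_dist n \<mu> \<nu>) ` X)"
  proof (rule bdd_aboveI2)
    fix \<mu>' assume \<mu>': "\<mu>' \<in> X"
    obtain \<nu> where \<nu>: "\<nu> \<in> Y" using Y by blast
    then have "(INF \<nu>\<in>Y. LP_dist n \<mu>' \<nu>) \<le> LP_dist n \<mu>' \<nu>" by (intro cINF_lower bdd \<mu>')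
    also have "\<dots> \<le> 1" using \<nu> \<mu>' X Y by (intro LP_dist_le_1) auto
    finally show "(INF \<nu>\<in>Y. LP_dist n \<mu>' \<nu>) \<le> 1" .
  qed
  then have "(INF \<nu>\<in>Y. LP_dist n \<mu> \<nu>) \<le> (SUP \<mu>\<in>X. INF \<nu>\<in>Y. LP_dist n \<mu> \<nu>)"
    by (rule cSUP_upper[OF \<mu>])
  also have "\<dots> < e" using less by (simp add: hausdorff_LP_def)
  finally show ?thesis using that Y by (auto simp: cINF_less_iff[OF _ bdd[OF \<mu>]])
qed

lemma hausdorff_LP_leI:
  assumes X: "X \<subseteq> Rprob n" "X \<noteq> {}" and Y: "Y \<subseteq> Rprob n" "Y \<noteq> {}"
    and 1: "\<And>\<mu>. \<mu> \<in> X \<Longrightarrow> \<exists>\<nu>\<in>Y. LP_dist n \<mu> \<nu> \<le> e"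
    and 2: "\<And>\<nu>. \<nu> \<in> Y \<Longrightarrow> \<exists>\<mu>\<in>X. LP_dist n \<mu> \<nu> \<le> e"
  shows "hausdorff_LP n X Y \<le> e"
proof -
  have "(INF \<nu>\<in>Y. LP_dist n \<mu> \<nu>) \<le> e" if "\<mu> \<in> X" for \<mu>
  proof -
    obtain \<nu> where "\<nu> \<in> Y" "LP_dist n \<mu> \<nu> \<le> e" using 1[OF \<open>\<mu> \<in> X\<close>] by blast
    then show ?thesis using that X Y
      by (intro cINF_lower2[of _ _ \<nu>] bdd_belowI2[of _ 0]) (auto intro: LP_dist_nonneg)
  qed
  moreover have "(INF \<mu>\<in>X. LP_dist n \<mu> \<nu>) \<le> e" if "\<nu> \<in> Y" for \<nu>
  proof -
    obtain \<mu> where "\<mu> \<in> X" "LP_dist n \<mu> \<nu> \<le> e" using 2[OF \<open>\<nu> \<in> Y\<close>] by blast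
    then show ?thesis using that X Y
      by (intro cINF_lower2[of _ _ \<mu>] bdd_belowI2[of _ 0]) (auto intro: LP_dist_nonneg)
  qed
  ultimately show ?thesis unfolding hausdorff_LP_def using X Y by (simp add: cSUP_least)
qed

lemma hausdorff_LP_nonneg:
  assumes X: "X \<subseteq> Rprob n" "X \<noteq> {}" and Y: "Y \<subseteq> Rprob n" "Y \<noteq> {}"
  shows "0 \<le> hausdorff_LP n X Y"
proof (rule ccontr)
  assume "\<not> 0 \<le> hausdorff_LP n X Y"
  moreover obtain \<mu> where \<mu>: "\<mu> \<in> X" using X by blast
  ultimately obtain \<nu> where "\<nu> \<in> Y" "LP_dist n \<mu> \<nu> < 0"
    using hausdorff_LP_lessD[OF X(1) Y _ \<mu>, of 0] by auto
  then show False using LP_dist_nonneg[of \<mu> n \<nu>] X Y \<mu> by auto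
qed

lemma hausdorff_LP_le_1:
  assumes X: "X \<subseteq> Rprob n" "X \<noteq> {}" and Y: "Y \<subseteq> Rprob n" "Y \<noteq> {}"
  shows "hausdorff_LP n X Y \<le> 1"
proof -
  have le: "LP_dist n \<mu> \<nu> \<le> 1" if "\<mu> \<in> X" "\<nu> \<in> Y" for \<mu> \<nu>
    using that X Y by (intro LP_dist_le_1) auto
  obtain \<mu> \<nu> where "\<mu> \<in> X" "\<nu> \<in> Y" using X Y by blast
  then show ?thesis by (intro hausdorff_LP_leI X Y bexI[of _ \<mu>] bexI[of _ \<nu>] le)
qed

lemma distr_in_Rprob: "prob_space M \<Longrightarrow> X \<in> measurable M (Rspace n) \<Longrightarrow> distr M (Rspace n) X \<in> Rprob n"
  by (simp add: Rprob_def prob_space.prob_space_distr)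

context loeb begin

text \<open>The two laws are compared cell by cell on a fine grid, finitely many cells of which carry
  almost all the mass.\<close>
lemma LP_dist_std_tendsto:
  fixes g :: "nat \<Rightarrow> nat \<Rightarrow> 'a \<Rightarrow> real"
  assumes g: "\<And>j. j < n \<Longrightarrow> ifun (g j)" and fin_g: "\<And>j. j < n \<Longrightarrow> AE b in L. fin (g j) b"
  shows "((\<lambda>i. LP_dist n (distr (P i) (Rspace n) (\<lambda>x. \<lambda>j\<in>{..<n}. g j i x))
    (distr L (Rspace n) (\<lambda>b. \<lambda>j\<in>{..<n}. std (g j) b))) \<longlongrightarrow> 0) U"
proof -
  have g_meas [measurable]: "g j i \<in> borel_measurable (P i)" if "j < n" for i j
    using g[OF that] by (simp add: ifun_def)
  have X: "(\<lambda>x. \<lambda>j\<in>{..<n}. g j i x) \<in> measurable (P i) (Rspace n)" for i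
    unfolding Rspace_def by (intro measurable_restrict g_meas) simp
  have Y: "(\<lambda>b. \<lambda>j\<in>{..<n}. std (g j) b) \<in> measurable L (Rspace n)"
    unfolding Rspace_def by (intro measurable_restrict measurable_std g) simp
  define F where "F = {b\<in>space L. \<forall>j\<in>{..<n}. fin (g j) b}"
  have "F \<in> sets L"
    unfolding F_def by (intro sets.sets_Collect_finite_All measurable_fin g) auto
  have "AE b in L. \<forall>j\<in>{..<n}. fin (g j) b"
    using fin_g by (intro AE_finite_allI) auto
  then have AE_F: "AE b in L. b \<in> F" using AE_space by eventually_elim (simp add: F_def)
  \<comment> \<open>Continuity from below makes some \<open>Good N\<close> carry almost all mass; it
    confines the vectors to a bounded box, which finitely many cells cover.\<close>
  define Good where "Good N = {b\<in>space L. \<forall>\<^sub>F i in U. \<forall>j\<in>{..<n}. \<bar>g j i (pt b i)\<bar> \<le> real N}" for N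
  have Good: "Good N \<in> sets L" for N
    unfolding Good_def
    by (intro sets_eventually sets.sets_Collect_finite_All) (auto intro!: borel_measurable_le)
  have "incseq Good"
  proof (intro incseq_SucI subsetI)
    fix N b assume b: "b \<in> Good N"
    then have "\<forall>\<^sub>F i in U. \<forall>j\<in>{..<n}. \<bar>g j i (pt b i)\<bar> \<le> real N" by (simp add: Good_def)
    then have "\<forall>\<^sub>F i in U. \<forall>j\<in>{..<n}. \<bar>g j i (pt b i)\<bar> \<le> real (Suc N)"
      by (rule eventually_mono) (intro ballI, drule (1) bspec, simp)
    then show "b \<in> Good (Suc N)" using b by (simp add: Good_def)
  qed
  then have "(\<lambda>N. measure L (Good N)) \<longlonglongrightarrow> measure L (\<Union>N. Good N)"
    using Good by (intro L.finite_Lim_measure_incseq) auto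
  moreover have "AE b in L. b \<in> (\<Union>N. Good N)"
    using AE_F
  proof eventually_elim
    case (elim b)
    then have "\<forall>j\<in>{..<n}. \<exists>N::nat. \<forall>\<^sub>F i in U. \<bar>g j i (pt b i)\<bar> \<le> real N"
      by (simp add: F_def fin_def)
    then obtain N :: "nat \<Rightarrow> nat" where N: "\<And>j. j \<in> {..<n} \<Longrightarrow> \<forall>\<^sub>F i in U. \<bar>g j i (pt b i)\<bar> \<le> real (N j)"
      by metis
    have "\<forall>\<^sub>F i in U. \<forall>j\<in>{..<n}. \<bar>g j i (pt b i)\<bar> \<le> real (\<Sum>j<n. N j)"
    proof (intro eventually_ball_finite ballI)
      fix j assume j: "j \<in> {..<n}"
      then have "N j \<le> (\<Sum>j<n. N j)" by (intro member_le_sum) auto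
      then have "real (N j) \<le> real (\<Sum>j<n. N j)" by (simp only: of_nat_le_iff)
      with N[OF j] show "\<forall>\<^sub>F i in U. \<bar>g j i (pt b i)\<bar> \<le> real (\<Sum>j<n. N j)"
        by (auto elim!: eventually_mono)
    qed simp
    then have "b \<in> Good (\<Sum>j<n. N j)" using elim by (simp add: Good_def F_def del: of_nat_sum)
    then show ?case by blast
  qed
  then have "measure L (\<Union>N. Good N) = 1"
    using Good by (intro L.prob_eq_1[THEN iffD2]) auto
  ultimately have Good_lim: "(\<lambda>N. measure L (Good N)) \<longlonglongrightarrow> 1" by simp
  show ?thesis
  proof (rule tendstoI)
    fix r :: real assume "0 < r"
    define e where "e = r / 2"
    have e: "0 < e" "e < r" using \<open>0 < r\<close> by (auto simp: e_def)
    \<comment> \<open>The mesh makes \<open>n\<close> coordinate errors add up to strictly less than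
      \<open>e\<close>; the extra 1 also covers \<open>n = 0\<close>.\<close>
    define \<delta> where "\<delta> = e / (real n + 1)"
    have \<delta>: "0 < \<delta>" "real n * \<delta> < e" using e by (auto simp: \<delta>_def field_simps)
    have "\<forall>\<^sub>F N in sequentially. 1 - e / 4 < measure L (Good N)"
      by (rule order_tendstoD(1)[OF Good_lim]) (use e in simp)
    then obtain N where N: "1 - e / 4 < measure L (Good N)"
      by (auto simp: eventually_sequentially)
    \<comment> \<open>The added 1 absorbs the rounding down of negative values.\<close>
    define K where "K = \<lceil>real N / \<delta>\<rceil> + 1"
    define Z where "Z = ({..<n} \<rightarrow>\<^sub>E {-K..K})"
    have Z: "finite Z" unfolding Z_def by (intro finite_PiE) auto
    define E where "E z i = {x\<in>space (P i). \<forall>j\<in>{..<n}. \<lfloor>g j i x / \<delta>\<rfloor> = z j}" for z :: "nat \<Rightarrow> int" and i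
    have E_sets: "E z i \<in> sets (P i)" for z i
      unfolding E_def
    proof (intro sets.sets_Collect_finite_All)
      fix j assume "j \<in> {..<n}"
      then have [measurable]: "g j i \<in> borel_measurable (P i)" by (simp add: g_meas)
      show "{x\<in>space (P i). \<lfloor>g j i x / \<delta>\<rfloor> = z j} \<in> sets (P i)" by measurable
    qed simp
    then have E: "imeasurable (E z)" for z by (simp add: imeasurable_def)
    \<comment> \<open>Intersecting with \<open>F\<close> changes no measure and makes every standard
      part on the cell a genuine limit, so closeness holds at each point, as the coupling
      demands.\<close>
    define E' where "E' z = internal (E z) \<inter> F" for z
    have E': "E' z \<in> sets L" for z
      unfolding E'_def using internal_sets[OF E] \<open>F \<in> sets L\<close> by auto
    have meas_E': "measure L (E' z) = measure L (internal (E z))" for z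
      using E' internal_sets[OF E] AE_F by (intro measure_eq_AE) (auto simp: E'_def elim!: eventually_mono)
    have disj: "E z i \<inter> E z' i = {}" if "z \<in> Z" "z' \<in> Z" "z \<noteq> z'" for z z' i
    proof -
      have "\<exists>j\<in>{..<n}. z j \<noteq> z' j"
      proof (rule ccontr)
        assume "\<not> (\<exists>j\<in>{..<n}. z j \<noteq> z' j)"
        then have eq: "\<And>j. j \<in> {..<n} \<Longrightarrow> z j = z' j" by blast
        have "z = z'" by (rule PiE_ext[OF that(1,2)[unfolded Z_def] eq])
        with that show False by blast
      qed
      then obtain j where "j \<in> {..<n}" "z j \<noteq> z' j" by blast
      then show ?thesis by (auto simp: E_def)
    qed
    then have disj_P: "disjoint_family_on (\<lambda>z. E z i) Z" for i by (auto simp: disjoint_family_on_def)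
    have disj_L: "disjoint_family_on E' Z"
      unfolding disjoint_family_on_def E'_def
    proof (intro ballI impI)
      fix z z' assume "z \<in> Z" "z' \<in> Z" "z \<noteq> z'"
      then have "internal (E z) \<inter> internal (E z') = {}"
        unfolding internal_Int[symmetric] using disj internal_empty by simp
      then show "internal (E z) \<inter> F \<inter> (internal (E z') \<inter> F) = {}" by blast
    qed
    have "Good N \<subseteq> (\<Union>z\<in>Z. E' z)"
    proof
      fix b assume b: "b \<in> Good N"
      have "fin (g j) b" if "j \<in> {..<n}" for j
        using b that by (intro finI[where C="real N"]) (auto simp: Good_def elim: eventually_mono)
      then have "b \<in> F" using b by (simp add: F_def Good_def)
      have "\<forall>\<^sub>F i in U. pt b i \<in> space (P i)" "\<forall>\<^sub>F i in U. \<forall>j\<in>{..<n}. \<bar>g j i (pt b i)\<bar> \<le> real N"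
        using b by (auto simp: Good_def in_space_L)
      then have "\<forall>\<^sub>F i in U. \<exists>z\<in>Z. pt b i \<in> E z i"
      proof eventually_elim
        case (elim i)
        define z where "z = (\<lambda>j\<in>{..<n}. \<lfloor>g j i (pt b i) / \<delta>\<rfloor>)"
        have "\<lfloor>g j i (pt b i) / \<delta>\<rfloor> \<in> {-K..K}" if "j < n" for j
        proof -
          have "\<bar>g j i (pt b i)\<bar> / \<delta> \<le> real N / \<delta>"
            using elim(2) that \<delta> by (intro divide_right_mono) auto
          also have "\<dots> \<le> real_of_int \<lceil>real N / \<delta>\<rceil>" by (rule le_of_int_ceiling)
          finally have "\<bar>g j i (pt b i) / \<delta>\<bar> \<le> real_of_int K - 1"
            using \<delta>(1) by (simp add: K_def)
          then show ?thesis unfolding atLeastAtMost_iff le_floor_iff floor_le_iff abs_le_iff of_int_minus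
            by linarith
        qed
        then have "z \<in> Z" by (auto simp: z_def Z_def)
        moreover have "pt b i \<in> E z i" using elim(1) by (simp add: E_def z_def)
        ultimately show ?case by blast
      qed
      from this[unfolded eventually_bex_finite[OF Z]]
      obtain z where "z \<in> Z" "b \<in> internal (E z)" by (auto simp: internal_def)
      with \<open>b \<in> F\<close> show "b \<in> (\<Union>z\<in>Z. E' z)" by (auto simp: E'_def)
    qed
    then have "measure L (Good N) \<le> measure L (\<Union>z\<in>Z. E' z)"
      using E' Z by (intro L.finite_measure_mono) auto
    also have "\<dots> = (\<Sum>z\<in>Z. measure L (E' z))"
      using E' Z disj_L by (intro L.finite_measure_finite_Union) auto
    finally have mass: "1 - e / 4 \<le> (\<Sum>z\<in>Z. measure L (E' z))" using N by simp
    have close: "dist_fin n (\<lambda>j\<in>{..<n}. std (g j) b) (\<lambda>j\<in>{..<n}. g j i x) < e"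
      if bx: "b \<in> E' z" "x \<in> E z i" for z b x i
    proof -
      \<comment> \<open>A limit of points of a half-open cell may land on its right end, so only
        closed bounds survive.\<close>
      have "\<bar>std (g j) b - g j i x\<bar> \<le> \<delta>" if j: "j < n" for j
      proof -
        have fl: "real_of_int k * \<delta> \<le> y \<and> y \<le> real_of_int k * \<delta> + \<delta>" if "\<lfloor>y / \<delta>\<rfloor> = k" for y k
        proof -
          have "real_of_int k \<le> y / \<delta>" "y / \<delta> < real_of_int k + 1" using that by linarith+
          then show ?thesis using \<delta>(1) by (simp add: field_simps)
        qed
        have "\<forall>\<^sub>F i in U. \<lfloor>g j i (pt b i) / \<delta>\<rfloor> = z j"
          using bx j by (auto simp: E'_def internal_def E_def elim: eventually_mono)
        then have ev: "\<forall>\<^sub>F i in U. real_of_int (z j) * \<delta> \<le> g j i (pt b i)"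
          "\<forall>\<^sub>F i in U. g j i (pt b i) \<le> real_of_int (z j) * \<delta> + \<delta>"
          by (auto elim!: eventually_mono dest: fl)
        have lim: "((\<lambda>i. g j i (pt b i)) \<longlongrightarrow> std (g j) b) U"
          using bx j by (intro tendsto_std) (auto simp: E'_def F_def)
        have "real_of_int (z j) * \<delta> \<le> std (g j) b"
          by (rule tendsto_lowerbound[OF lim ev(1) U_nonbot])
        moreover have "std (g j) b \<le> real_of_int (z j) * \<delta> + \<delta>"
          by (rule tendsto_upperbound[OF lim ev(2) U_nonbot])
        moreover have "\<lfloor>g j i x / \<delta>\<rfloor> = z j" using bx j by (auto simp: E_def)
        note fl[OF this]
        ultimately show ?thesis by linarith
      qed
      then have "dist_fin n (\<lambda>j\<in>{..<n}. std (g j) b) (\<lambda>j\<in>{..<n}. g j i x) \<le> real n * \<delta>"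
        by (intro dist_fin_le) simp
      then show ?thesis using \<delta>(2) by simp
    qed
    have "((\<lambda>i. \<Sum>z\<in>Z. \<bar>measure L (E' z) - measure (P i) (E z i)\<bar>) \<longlongrightarrow>
      (\<Sum>z\<in>Z. \<bar>measure L (E' z) - measure L (internal (E z))\<bar>)) U"
      by (intro tendsto_intros tendsto_measure_internal E)
    then have "\<forall>\<^sub>F i in U. (\<Sum>z\<in>Z. \<bar>measure L (E' z) - measure (P i) (E z i)\<bar>) < e / 4"
      by (rule order_tendstoD) (use e meas_E' in simp)
    then show "\<forall>\<^sub>F i in U. dist (LP_dist n (distr (P i) (Rspace n) (\<lambda>x. \<lambda>j\<in>{..<n}. g j i x))
      (distr L (Rspace n) (\<lambda>b. \<lambda>j\<in>{..<n}. std (g j) b))) 0 < r"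
    proof eventually_elim
      case (elim i)
      have "LP_dist n (distr L (Rspace n) (\<lambda>b. \<lambda>j\<in>{..<n}. std (g j) b))
         (distr (P i) (Rspace n) (\<lambda>x. \<lambda>j\<in>{..<n}. g j i x)) \<le> e"
        by (rule LP_dist_coupling[OF L.prob_space_axioms prob_P Y X Z E' E_sets disj_L disj_P _ mass e(1)])
           (use elim close in auto)
      moreover have "0 \<le> LP_dist n (distr (P i) (Rspace n) (\<lambda>x. \<lambda>j\<in>{..<n}. g j i x))
         (distr L (Rspace n) (\<lambda>b. \<lambda>j\<in>{..<n}. std (g j) b))"
        by (intro LP_dist_nonneg distr_in_Rprob prob_P L.prob_space_axioms X Y)
      ultimately show ?case using e by (simp add: LP_dist_commute)
    qed
  qed
qed

end

section \<open>The limit operator\<close>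

lemma P_operator_facts:
  assumes "P_operator M A"
  shows P_operator_prob: "prob_space M"
    and P_operator_integrable: "\<And>v. v \<in> Linf M \<Longrightarrow> integrable M (A v)"
    and P_operator_cong: "\<And>v w. v \<in> Linf M \<Longrightarrow> w \<in> Linf M \<Longrightarrow> AE x in M. v x = w x \<Longrightarrow> AE x in M. A v x = A w x"
    and P_operator_add: "\<And>v w. v \<in> Linf M \<Longrightarrow> w \<in> Linf M \<Longrightarrow> AE x in M. A (\<lambda>y. v y + w y) x = A v x + A w x"
    and P_operator_scale: "\<And>v k. v \<in> Linf M \<Longrightarrow> AE x in M. A (\<lambda>y. k * v y) x = k * A v x"
  using assms unfolding P_operator_def by blast+

lemma Linf_scale: "v \<in> Linf M \<Longrightarrow> (\<lambda>y. k * v y) \<in> Linf M"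
proof -
  assume "v \<in> Linf M"
  then obtain C where v: "v \<in> borel_measurable M" and C: "AE x in M. \<bar>v x\<bar> \<le> C" by (auto simp: Linf_def)
  have "AE x in M. \<bar>k * v x\<bar> \<le> \<bar>k\<bar> * C"
    using C by eventually_elim (simp add: abs_mult mult_left_mono)
  with v show ?thesis by (auto simp: Linf_def)
qed

lemma P_operator_diff:
  assumes A: "P_operator M A" and v: "v \<in> Linf M" and w: "w \<in> Linf M"
  shows "AE x in M. A (\<lambda>y. v y - w y) x = A v x - A w x"
  using P_operator_add[OF A v Linf_scale[OF w, of "-1"]] P_operator_scale[OF A w, of "-1"]
  by eventually_elim simp

section \<open>Moment bounds for a single operator\<close>

lemma Lp_norm_real:
  assumes "integrable M (\<lambda>x. \<bar>f x\<bar> powr p)"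
  shows "Lp_norm M p f = ennreal ((\<integral>x. \<bar>f x\<bar> powr p \<partial>M) powr (1 / p))"
proof -
  have "(\<integral>\<^sup>+x. ennreal (\<bar>f x\<bar> powr p) \<partial>M) = ennreal (\<integral>x. \<bar>f x\<bar> powr p \<partial>M)"
    using assms by (intro nn_integral_eq_integral) auto
  then show ?thesis by (simp add: Lp_norm_def)
qed

lemma Lp_norm_finiteD:
  assumes f: "f \<in> borel_measurable M" and le: "Lp_norm M p f \<le> ennreal K" and K: "0 \<le> K" and p: "0 < p"
  shows "integrable M (\<lambda>x. \<bar>f x\<bar> powr p)" and "(\<integral>x. \<bar>f x\<bar> powr p \<partial>M) \<le> K powr p"
proof -
  let ?I = "\<integral>\<^sup>+x. ennreal (\<bar>f x\<bar> powr p) \<partial>M"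
  have "?I \<noteq> \<infinity>"
    using le by (auto simp: Lp_norm_def Let_def top_unique split: if_splits)
  then show int: "integrable M (\<lambda>x. \<bar>f x\<bar> powr p)"
    using f by (intro integrableI_nonneg) (auto simp: top.not_eq_extremum)
  let ?J = "\<integral>x. \<bar>f x\<bar> powr p \<partial>M"
  have "?J powr (1 / p) \<le> K" using le K unfolding Lp_norm_real[OF int] by simp
  then have "(?J powr (1 / p)) powr p \<le> K powr p"
    using p by (intro powr_mono2) auto
  moreover have "0 \<le> ?J" by (rule integral_nonneg_AE) simp
  ultimately show "?J \<le> K powr p" using p by (simp add: powr_powr)
qed

text \<open>Turns the norm bound into an inequality between real integrals. The free bound
  \<open>s\<close> serves both for constants and for \<open>p\<close>-th moments that tend to
  0.\<close>

lemma op_Lq_bound: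
  assumes A: "P_operator M A" and p: "1 \<le> p" and q: "1 < q" and c: "0 < c"
    and bound: "pq_norm M p q A \<le> ennreal c" and v: "v \<in> Linf M"
    and s: "(\<integral>x. \<bar>v x\<bar> powr p \<partial>M) \<le> s"
  shows "integrable M (\<lambda>x. \<bar>A v x\<bar> powr q)"
    and "(\<integral>x. \<bar>A v x\<bar> powr q \<partial>M) \<le> (c * s powr (1 / p)) powr q"
proof -
  interpret prob_space M by (rule P_operator_prob[OF A])
  obtain C where C: "AE x in M. \<bar>v x\<bar> \<le> C" and [measurable]: "v \<in> borel_measurable M"
    using v by (auto simp: Linf_def)
  have [measurable]: "A v \<in> borel_measurable M"
    using P_operator_integrable[OF A v] by simp
  have int: "integrable M (\<lambda>x. \<bar>v x\<bar> powr p)"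
  proof (rule integrable_const_bound)
    show "AE x in M. norm (\<bar>v x\<bar> powr p) \<le> C powr p"
      using C by eventually_elim (use p in \<open>auto intro!: powr_mono2\<close>)
  qed simp
  let ?N = "(\<integral>x. \<bar>v x\<bar> powr p \<partial>M) powr (1 / p)"
  have I0: "0 \<le> (\<integral>x. \<bar>v x\<bar> powr p \<partial>M)" by (rule integral_nonneg_AE) simp
  have norm_v: "Lp_norm M p v = ennreal ?N" by (rule Lp_norm_real[OF int])
  have "Lp_norm M q (A v) \<le> ennreal (c * ?N)"
  proof (cases "?N = 0")
    case True
    then have "(\<integral>x. \<bar>v x\<bar> powr p \<partial>M) = 0" by simp
    then have "AE x in M. \<bar>v x\<bar> powr p = 0"
      by (subst (asm) integral_nonneg_eq_0_iff_AE[OF int]) auto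
    \<comment> \<open>Null functions are excluded from the supremum defining \<open>pq_norm\<close>.
      Homogeneity with factor 0 and compatibility with a.e. equality show that their images
      vanish.\<close>
    then have "AE x in M. v x = 0 * v x" by eventually_elim simp
    then have "AE x in M. A v x = A (\<lambda>x. 0 * v x) x"
      by (intro P_operator_cong[OF A] v Linf_scale)
    then have Av: "AE x in M. A v x = 0"
      using P_operator_scale[OF A v, of 0] by eventually_elim simp
    then have "AE x in M. \<bar>A v x\<bar> powr q = 0" by eventually_elim simp
    then have "(\<integral>\<^sup>+x. ennreal (\<bar>A v x\<bar> powr q) \<partial>M) = 0"
      by (subst nn_integral_0_iff_AE) (auto elim!: eventually_mono)
    then show ?thesis by (simp add: Lp_norm_def)
  next
    case False
    then have N: "0 < ?N" by (metis powr_ge_zero order_le_less)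
    have "Lp_norm M q (A v) / Lp_norm M p v \<le> pq_norm M p q A"
      unfolding pq_norm_def using v False norm_v N by (intro SUP_upper) auto
    also note bound
    finally have le: "Lp_norm M q (A v) / ennreal ?N \<le> ennreal c" by (simp add: norm_v)
    have "ennreal ?N / ennreal ?N = 1" by (rule ennreal_divide_self) (use N in auto)
    then have "Lp_norm M q (A v) = Lp_norm M q (A v) / ennreal ?N * ennreal ?N"
      by (simp only: ennreal_divide_times mult_1_right)
    also have "\<dots> \<le> ennreal c * ennreal ?N" by (intro mult_right_mono le) simp
    finally show ?thesis using c by (simp add: ennreal_mult)
  qed
  then have le: "Lp_norm M q (A v) \<le> ennreal (c * ?N)" .
  show "integrable M (\<lambda>x. \<bar>A v x\<bar> powr q)"
    using q c by (intro Lp_norm_finiteD(1)[OF _ le]) auto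
  have "(\<integral>x. \<bar>A v x\<bar> powr q \<partial>M) \<le> (c * ?N) powr q"
    using q c by (intro Lp_norm_finiteD(2)[OF _ le]) auto
  also have "\<dots> \<le> (c * s powr (1 / p)) powr q"
    using p q c s I0 by (intro powr_mono2 mult_left_mono) auto
  finally show "(\<integral>x. \<bar>A v x\<bar> powr q \<partial>M) \<le> (c * s powr (1 / p)) powr q" .
qed

section \<open>Lifts and the limit operator on the Loeb space\<close>

locale loeb_op = loeb U P pt
  for U :: "nat filter" and P :: "nat \<Rightarrow> 'a measure" and pt :: "'b \<Rightarrow> nat \<Rightarrow> 'a" +
  fixes A :: "nat \<Rightarrow> ('a \<Rightarrow> real) \<Rightarrow> 'a \<Rightarrow> real" and p q c :: real
  assumes A_op: "\<And>i. P_operator (P i) (A i)"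
    and p: "1 \<le> p" and q: "1 < q" and c: "0 < c"
    and A_bound: "\<And>i. pq_norm (P i) p q (A i) \<le> ennreal c"
begin

definition bfun :: "real \<Rightarrow> (nat \<Rightarrow> 'a \<Rightarrow> real) \<Rightarrow> bool" where
  "bfun C v \<longleftrightarrow> ifun v \<and> (\<forall>i. \<forall>x\<in>space (P i). \<bar>v i x\<bar> \<le> C)"

definition lift :: "(nat \<Rightarrow> 'a \<Rightarrow> real) \<Rightarrow> ('b \<Rightarrow> real) \<Rightarrow> bool" where
  "lift v f \<longleftrightarrow> (\<exists>C. bfun C v) \<and> (AE b in L. ((\<lambda>i. v i (pt b i)) \<longlongrightarrow> f b) U)"

definition app :: "(nat \<Rightarrow> 'a \<Rightarrow> real) \<Rightarrow> nat \<Rightarrow> 'a \<Rightarrow> real" where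
  "app v i = A i (v i)"

text \<open>The choice of the lift only matters up to a null set.\<close>
definition Alim :: "('b \<Rightarrow> real) \<Rightarrow> 'b \<Rightarrow> real" where
  "Alim f = std (app (SOME v. lift v f))"

lemma bfunI:
  assumes "\<And>i. v i \<in> borel_measurable (P i)" "\<And>i x. x \<in> space (P i) \<Longrightarrow> \<bar>v i x\<bar> \<le> C"
  shows "bfun C v"
  using assms by (simp add: bfun_def ifun_def)

lemma bfunD:
  assumes "bfun C v"
  shows "v i \<in> borel_measurable (P i)" "x \<in> space (P i) \<Longrightarrow> \<bar>v i x\<bar> \<le> C"
  using assms by (simp_all add: bfun_def ifun_def)

lemma bfun_Linf: "bfun C v \<Longrightarrow> v i \<in> Linf (P i)"
  by (auto simp: bfun_def ifun_def Linf_def intro!: exI[of _ C])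

lemma ifun_app: "bfun C v \<Longrightarrow> ifun (app v)"
  using P_operator_integrable[OF A_op bfun_Linf] by (auto simp: ifun_def app_def)

lemma bfun_powr_integral:
  assumes "bfun C v" "0 \<le> C"
  shows "(\<integral>x. \<bar>v i x\<bar> powr p \<partial>P i) \<le> C powr p"
proof -
  interpret prob_space "P i" by (rule prob_P)
  have "(\<integral>x. \<bar>v i x\<bar> powr p \<partial>P i) \<le> (\<integral>x. C powr p \<partial>P i)"
  proof (rule integral_mono)
    have [measurable]: "v i \<in> borel_measurable (P i)" using assms by (simp add: bfun_def ifun_def)
    show "\<bar>v i x\<bar> powr p \<le> C powr p" if "x \<in> space (P i)" for x
      using assms p that by (intro powr_mono2) (auto simp: bfun_def)
    then show "integrable (P i) (\<lambda>x. \<bar>v i x\<bar> powr p)"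
      by (intro integrable_const_bound[where B="C powr p"]) auto
  qed simp
  then show ?thesis by (simp add: prob_space)
qed

lemma app_Lq:
  assumes "bfun C v" "0 \<le> C"
  shows "integrable (P i) (\<lambda>x. \<bar>app v i x\<bar> powr q)"
    and "(\<integral>x. \<bar>app v i x\<bar> powr q \<partial>P i) \<le> (c * C) powr q"
proof -
  note * = op_Lq_bound[OF A_op p q c A_bound bfun_Linf[OF assms(1)] bfun_powr_integral[OF assms], of i]
  show "integrable (P i) (\<lambda>x. \<bar>app v i x\<bar> powr q)" using *(1) by (simp add: app_def)
  show "(\<integral>x. \<bar>app v i x\<bar> powr q \<partial>P i) \<le> (c * C) powr q"
    using *(2) assms(2) p by (simp add: app_def powr_powr)
qed

lemma bfun_mono: "bfun C v \<Longrightarrow> C \<le> D \<Longrightarrow> bfun D v"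
  by (auto simp: bfun_def intro: order_trans)

lemma fin_app:
  assumes "bfun C v"
  shows "AE b in L. fin (app v) b"
proof -
  have "bfun (max 0 C) v" using assms by (rule bfun_mono) simp
  then show ?thesis
    using integral_tendsto_powr_bounded(3)[OF q ifun_app app_Lq] by simp
qed

lemma bfun_diff: "bfun C v \<Longrightarrow> bfun D w \<Longrightarrow> bfun (C + D) (\<lambda>i x. v i x - w i x)"
  by (intro bfunI borel_measurable_diff order_trans[OF abs_triangle_ineq4] add_mono) (auto dest: bfunD)

text \<open>The \<open>p\<close>-th powers of the difference of the lifts are bounded with standard
  part 0 almost everywhere, so their integrals tend to 0. The bound passes this to the
  \<open>q\<close>-th moments of the images, and \<open>AE_tendsto_0\<close> turns it back into a
  pointwise statement.\<close>

lemma app_lift_unique: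
  assumes v: "lift v f" and w: "lift w g" and fg: "AE b in L. f b = g b"
  shows "AE b in L. ((\<lambda>i. app v i (pt b i) - app w i (pt b i)) \<longlongrightarrow> 0) U"
proof -
  obtain C D where CD: "bfun C v" "bfun D w" using v w by (auto simp: lift_def)
  define u where "u i x = v i x - w i x" for i x
  define K where "K = max 0 (C + D)"
  have u: "bfun K u"
    unfolding u_def K_def by (rule bfun_mono[OF bfun_diff[OF CD]]) simp
  then have [measurable]: "u i \<in> borel_measurable (P i)" for i by (simp add: bfun_def ifun_def)
  have K: "0 \<le> K" by (simp add: K_def)
  define h where "h i x = \<bar>u i x\<bar> powr p" for i x
  have h: "ifun h" unfolding ifun_def h_def by measurable
  have h_bd: "\<bar>h i x\<bar> \<le> K powr p" if "x \<in> space (P i)" for i x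
    using u p that by (auto simp: h_def bfun_def intro!: powr_mono2)
  from v w have "AE b in L. ((\<lambda>i. v i (pt b i)) \<longlongrightarrow> f b) U" "AE b in L. ((\<lambda>i. w i (pt b i)) \<longlongrightarrow> g b) U"
    by (simp_all add: lift_def)
  then have "AE b in L. std h b = 0"
    using fg
  proof eventually_elim
    case (elim b)
    have "((\<lambda>i. u i (pt b i)) \<longlongrightarrow> f b - g b) U"
      unfolding u_def by (intro tendsto_diff elim)
    then have "((\<lambda>i. \<bar>u i (pt b i)\<bar>) \<longlongrightarrow> 0) U"
      using elim(3) by (simp add: tendsto_rabs_zero)
    then have "((\<lambda>i. h i (pt b i)) \<longlongrightarrow> 0) U"
      unfolding h_def using p by (intro tendsto_zero_powrI[where b=p]) auto
    then show ?case by (rule std_eqI)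
  qed
  then have "(\<integral>b. std h b \<partial>L) = 0"
    by (simp add: integral_eq_zero_AE)
  with integral_bounded(1)[OF h h_bd] have lim: "((\<lambda>i. \<integral>x. h i x \<partial>P i) \<longlongrightarrow> 0) U" by simp
  define r where "r i = (\<integral>x. \<bar>app u i x\<bar> powr q \<partial>P i)" for i
  have r: "integrable (P i) (\<lambda>x. \<bar>app u i x\<bar> powr q)"
    "r i \<le> (c * (\<integral>x. h i x \<partial>P i) powr (1 / p)) powr q" for i
    using op_Lq_bound[OF A_op p q c A_bound bfun_Linf[OF u] order_refl, of i]
    by (simp_all add: app_def h_def r_def)
  have h_nonneg: "0 \<le> (\<integral>x. h i x \<partial>P i)" for i
    by (rule integral_nonneg_AE) (simp add: h_def)
  have "((\<lambda>i. (c * (\<integral>x. h i x \<partial>P i) powr (1 / p)) powr q) \<longlongrightarrow> 0) U"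
  proof (rule tendsto_zero_powrI[where b=q])
    have "((\<lambda>i. (\<integral>x. h i x \<partial>P i) powr (1 / p)) \<longlongrightarrow> 0) U"
      using lim p h_nonneg by (intro tendsto_zero_powrI[where b="1/p"]) auto
    then show "((\<lambda>i. c * (\<integral>x. h i x \<partial>P i) powr (1 / p)) \<longlongrightarrow> 0) U"
      by (rule tendsto_mult_right_zero)
  qed (use q c in auto)
  then have "(r \<longlongrightarrow> 0) U"
  proof (rule tendsto_sandwich[OF _ _ tendsto_const, rotated 2])
    show "\<forall>\<^sub>F i in U. 0 \<le> r i" unfolding r_def by (intro always_eventually allI integral_nonneg_AE) simp
    show "\<forall>\<^sub>F i in U. r i \<le> (c * (\<integral>x. h i x \<partial>P i) powr (1 / p)) powr q"
      by (intro always_eventually allI r)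
  qed
  then have "AE b in L. ((\<lambda>i. \<bar>app u i (pt b i)\<bar> powr q) \<longlongrightarrow> 0) U"
    using r(1) by (intro AE_tendsto_0) (auto simp: r_def[abs_def])
  \<comment> \<open>Linearity holds only almost everywhere on each \<open>P i\<close>, and so it
    reaches the limit only through \<open>AE_eventually\<close>.\<close>
  moreover have "AE b in L. \<forall>\<^sub>F i in U. app u i (pt b i) = app v i (pt b i) - app w i (pt b i)"
  proof (rule AE_eventually)
    have "app u i \<in> borel_measurable (P i)" "app v i \<in> borel_measurable (P i)" "app w i \<in> borel_measurable (P i)" for i
      using ifun_app[OF u] ifun_app[OF CD(1)] ifun_app[OF CD(2)] by (auto simp: ifun_def)
    then show "{x\<in>space (P i). app u i x = app v i x - app w i x} \<in> sets (P i)" for i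
      by (intro borel_measurable_eq borel_measurable_diff)
    show "AE x in P i. app u i x = app v i x - app w i x" for i
      using P_operator_diff[OF A_op bfun_Linf[OF CD(1)] bfun_Linf[OF CD(2)], of i]
      by (simp add: app_def u_def[abs_def])
  qed
  ultimately show ?thesis
  proof eventually_elim
    case (elim b)
    have "((\<lambda>i. (\<bar>app u i (pt b i)\<bar> powr q) powr (1 / q)) \<longlongrightarrow> 0) U"
      using elim(1) q
      by (intro tendsto_zero_powrI[where f="\<lambda>i. \<bar>app u i (pt b i)\<bar> powr q" and g="\<lambda>_. 1/q" and b="1/q"]) auto
    then have "((\<lambda>i. \<bar>app u i (pt b i)\<bar>) \<longlongrightarrow> 0) U" using q by (simp add: powr_powr)
    then have "((\<lambda>i. app u i (pt b i)) \<longlongrightarrow> 0) U" by (rule tendsto_rabs_zero_cancel)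
    then show ?case using elim(2) by (rule Lim_transform_eventually)
  qed
qed

lemma lift_exists:
  assumes "f \<in> borel_measurable L" "AE b in L. \<bar>f b\<bar> \<le> C" "0 < C"
  obtains v where "bfun C v" "lift v f" "\<And>i x. \<bar>v i x\<bar> \<le> C"
proof -
  obtain v where v: "ifun v" "\<And>i x. \<bar>v i x\<bar> \<le> C" "AE b in L. ((\<lambda>i. v i (pt b i)) \<longlongrightarrow> f b) U"
    using lift_bounded[OF assms] by blast
  then show ?thesis using that[of v] by (auto simp: bfun_def lift_def)
qed

lemma Linf_lift:
  assumes "f \<in> Linf L"
  obtains v where "lift v f"
proof -
  obtain C where C: "f \<in> borel_measurable L" "AE b in L. \<bar>f b\<bar> \<le> C" using assms by (auto simp: Linf_def)
  have "AE b in L. \<bar>f b\<bar> \<le> max 1 C" using C(2) by eventually_elim simp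
  from lift_exists[OF C(1) this] show ?thesis using that by (metis less_max_iff_disj zero_less_one)
qed

text \<open>Frees \<open>Alim\<close> from the lift chosen in its definition: any convenient lift
  computes it almost everywhere.\<close>

lemma tendsto_Alim:
  assumes v: "lift v f"
  shows "AE b in L. ((\<lambda>i. app v i (pt b i)) \<longlongrightarrow> Alim f b) U"
proof -
  define w where "w = (SOME v. lift v f)"
  have w: "lift w f" unfolding w_def by (rule someI[of "\<lambda>v. lift v f", OF v])
  then obtain C where "bfun C w" by (auto simp: lift_def)
  then have "AE b in L. fin (app w) b" by (rule fin_app)
  then show ?thesis
    using app_lift_unique[OF v w AE_I2[OF refl]]
  proof eventually_elim
    case (elim b)
    have "((\<lambda>i. (app v i (pt b i) - app w i (pt b i)) + app w i (pt b i)) \<longlongrightarrow> 0 + std (app w) b) U"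
      using elim by (intro tendsto_add tendsto_std) auto
    then show ?case by (simp add: Alim_def w_def)
  qed
qed

lemma Alim_eq_std:
  assumes "lift v f"
  shows "AE b in L. std (app v) b = Alim f b"
  using tendsto_Alim[OF assms] by eventually_elim (rule std_eqI)

lemma measurable_Alim:
  assumes "f \<in> Linf L"
  shows "Alim f \<in> borel_measurable L"
proof -
  have "lift (SOME v. lift v f) f" using Linf_lift[OF assms] by (metis someI)
  then show ?thesis unfolding Alim_def lift_def by (blast intro: measurable_std ifun_app)
qed

lemma Alim_unique:
  assumes "lift v f" and "AE b in L. ((\<lambda>i. app v i (pt b i)) \<longlongrightarrow> k b) U"
  shows "AE b in L. Alim f b = k b"
  using tendsto_Alim[OF assms(1)] assms(2)
  by eventually_elim (rule tendsto_unique[OF U_nonbot])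

lemma integrable_Alim:
  assumes "f \<in> Linf L"
  shows "integrable L (Alim f)"
proof -
  have "lift (SOME v. lift v f) f" using Linf_lift[OF assms] by (metis someI)
  then obtain C where "bfun C (SOME v. lift v f)" by (auto simp: lift_def)
  then have *: "bfun (max 0 C) (SOME v. lift v f)" by (rule bfun_mono) simp
  show ?thesis
    unfolding Alim_def by (rule integral_tendsto_powr_bounded(2)[OF q ifun_app[OF *] app_Lq[OF *]]) simp_all
qed

text \<open>The factor 2 comes from \<open>\<bar>y\<bar> \<le> 1 + \<bar>y\<bar> powr q\<close>, a
  crude substitute for monotonicity of the norms in the exponent.\<close>

lemma Alim_norm_pos:
  assumes f: "f \<in> borel_measurable L" and B: "AE b in L. \<bar>f b\<bar> \<le> B" "0 < B"
  shows "(\<integral>b. \<bar>Alim f b\<bar> \<partial>L) \<le> 2 * c * B"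
proof -
  obtain v where v: "bfun B v" "lift v f" using lift_exists[OF f B] by metis
  have "f \<in> Linf L" using f B unfolding Linf_def by blast
  have int: "integrable (P i) (app v i)" for i
    using P_operator_integrable[OF A_op bfun_Linf[OF v(1)]] by (simp add: app_def)
  have "(\<integral>x. \<bar>app v i x\<bar> \<partial>P i) \<le> 2 * c * B" for i
  proof -
    interpret prob_space "P i" by (rule prob_P)
    \<comment> \<open>Applying the inequality to \<open>y / s\<close>, with \<open>s\<close> the
      bound on the \<open>q\<close>-norm of the image, makes the estimate linear in
      \<open>B\<close>. The division is why \<open>B\<close> must be positive here.\<close>
    define s where "s = c * B"
    have s: "0 < s" using c B by (simp add: s_def)
    have Lq: "integrable (P i) (\<lambda>x. \<bar>app v i x\<bar> powr q)" "(\<integral>x. \<bar>app v i x\<bar> powr q \<partial>P i) \<le> s powr q"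
      using app_Lq[OF v(1)] B by (auto simp: s_def)
    have "\<bar>app v i x\<bar> \<le> s + s * (\<bar>app v i x\<bar> powr q / s powr q)" for x
    proof -
      have eq: "\<bar>app v i x / s\<bar> = \<bar>app v i x\<bar> / s" using s by simp
      have "\<bar>app v i x\<bar> / s \<le> 1 + (\<bar>app v i x\<bar> / s) powr q"
        using le_one_plus_powr[OF q, of "app v i x / s"] unfolding eq .
      also have "(\<bar>app v i x\<bar> / s) powr q = \<bar>app v i x\<bar> powr q / s powr q"
        using s by (simp add: powr_divide)
      finally have "\<bar>app v i x\<bar> / s \<le> 1 + \<bar>app v i x\<bar> powr q / s powr q" .
      then have "s * (\<bar>app v i x\<bar> / s) \<le> s * (1 + \<bar>app v i x\<bar> powr q / s powr q)"
        using s by (intro mult_left_mono) auto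
      then show ?thesis using s by (simp add: distrib_left)
    qed
    then have "(\<integral>x. \<bar>app v i x\<bar> \<partial>P i) \<le> (\<integral>x. s + s * (\<bar>app v i x\<bar> powr q / s powr q) \<partial>P i)"
      using int Lq by (intro integral_mono integrable_abs) auto
    also have "\<dots> = s + s * ((\<integral>x. \<bar>app v i x\<bar> powr q \<partial>P i) / s powr q)"
      using Lq by (simp add: prob_space)
    also have "\<dots> \<le> s + s * 1"
      using Lq s by (intro add_mono mult_left_mono) (auto simp: divide_le_eq)
    finally show ?thesis by (simp add: s_def mult_ac)
  qed
  then have "(\<integral>b. \<bar>std (app v) b\<bar> \<partial>L) \<le> 2 * c * B"
    by (rule integral_std_le(2)[OF int])
  moreover have "(\<integral>b. \<bar>std (app v) b\<bar> \<partial>L) = (\<integral>b. \<bar>Alim f b\<bar> \<partial>L)"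
    using Alim_eq_std[OF v(2)] measurable_std[OF ifun_app[OF v(1)]] measurable_Alim[OF \<open>f \<in> Linf L\<close>]
    by (intro integral_cong_AE) (auto elim!: eventually_mono)
  ultimately show ?thesis by simp
qed

text \<open>\<open>P_operator\<close> quantifies over every essential bound, including 0; enlarging
  \<open>B\<close> by \<open>e / (2 * c)\<close> reduces to the positive case at cost
  \<open>e\<close>.\<close>

lemma Alim_norm:
  assumes f: "f \<in> Linf L" and B: "AE b in L. \<bar>f b\<bar> \<le> B"
  shows "(\<integral>b. \<bar>Alim f b\<bar> \<partial>L) \<le> 2 * c * B"
proof (rule field_le_epsilon)
  fix e :: real assume e: "0 < e"
  have "AE b in L. 0 \<le> B" using B by eventually_elim linarith
  then have "0 \<le> B" by simp
  have "AE b in L. \<bar>f b\<bar> \<le> B + e / (2 * c)"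
    using B by eventually_elim (use e c in \<open>simp add: add_increasing2\<close>)
  moreover have "0 < B + e / (2 * c)" using e c \<open>0 \<le> B\<close> by (intro add_nonneg_pos) auto
  ultimately have "(\<integral>b. \<bar>Alim f b\<bar> \<partial>L) \<le> 2 * c * (B + e / (2 * c))"
    using f by (intro Alim_norm_pos) (auto simp: Linf_def)
  also have "\<dots> = 2 * c * B + e" using c by (simp add: distrib_left)
  finally show "(\<integral>b. \<bar>Alim f b\<bar> \<partial>L) \<le> 2 * c * B + e" .
qed

lemma lift_cong: "lift v f \<Longrightarrow> AE b in L. f b = g b \<Longrightarrow> lift v g"
  unfolding lift_def by (elim conjE, rule conjI, assumption, elim AE_mp) auto

lemma P_operator_Alim: "P_operator L Alim"
  unfolding P_operator_def
proof (intro conjI ballI allI impI)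
  show "prob_space L" by (rule L.prob_space_axioms)
  show "integrable L (Alim f)" if "f \<in> Linf L" for f using that by (rule integrable_Alim)
next
  fix f g assume "f \<in> Linf L" and fg: "AE b in L. f b = g b"
  then obtain v where v: "lift v f" using Linf_lift by blast
  from Alim_unique[OF this tendsto_Alim[OF lift_cong[OF v fg]]]
  show "AE b in L. Alim f b = Alim g b" .
next
  fix f g assume "f \<in> Linf L" "g \<in> Linf L"
  then obtain v w where v: "lift v f" and w: "lift w g" using Linf_lift by metis
  then obtain C D where CD: "bfun C v" "bfun D w" by (auto simp: lift_def)
  define u where "u i x = v i x + w i x" for i x
  have u: "bfun (C + D) u"
    using CD unfolding u_def
    by (intro bfunI borel_measurable_add order_trans[OF abs_triangle_ineq] add_mono) (auto dest: bfunD)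
  have "lift u (\<lambda>b. f b + g b)"
    using u v w unfolding lift_def u_def by (auto elim!: eventually_elim2 intro: tendsto_add)
  moreover have "AE b in L. \<forall>\<^sub>F i in U. app u i (pt b i) = app v i (pt b i) + app w i (pt b i)"
  proof (rule AE_eventually)
    have "app u i \<in> borel_measurable (P i)" "app v i \<in> borel_measurable (P i)" "app w i \<in> borel_measurable (P i)" for i
      using ifun_app[OF u] ifun_app[OF CD(1)] ifun_app[OF CD(2)] by (auto simp: ifun_def)
    then show "{x\<in>space (P i). app u i x = app v i x + app w i x} \<in> sets (P i)" for i
      by (intro borel_measurable_eq borel_measurable_add)
    show "AE x in P i. app u i x = app v i x + app w i x" for i
      using P_operator_add[OF A_op bfun_Linf[OF CD(1)] bfun_Linf[OF CD(2)], of i]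
      by (simp add: app_def u_def[abs_def])
  qed
  then have "AE b in L. ((\<lambda>i. app u i (pt b i)) \<longlongrightarrow> Alim f b + Alim g b) U"
    using tendsto_Alim[OF v] tendsto_Alim[OF w]
  proof eventually_elim
    case (elim b)
    show ?case
      by (rule Lim_transform_eventually[OF tendsto_add[OF elim(2,3)]])
         (use elim(1) in \<open>auto elim: eventually_mono\<close>)
  qed
  ultimately show "AE b in L. Alim (\<lambda>b. f b + g b) b = Alim f b + Alim g b" by (rule Alim_unique)
next
  fix f and k :: real assume "f \<in> Linf L"
  then obtain v where v: "lift v f" using Linf_lift by metis
  then obtain C where C: "bfun C v" by (auto simp: lift_def)
  define u where "u i x = k * v i x" for i x
  have u: "bfun (\<bar>k\<bar> * C) u"
    unfolding u_def
  proof (rule bfunI)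
    show "(\<lambda>x. k * v i x) \<in> borel_measurable (P i)" for i
      using bfunD(1)[OF C] by (intro borel_measurable_times) auto
    show "\<bar>k * v i x\<bar> \<le> \<bar>k\<bar> * C" if "x \<in> space (P i)" for i x
      using bfunD(2)[OF C that] by (simp add: abs_mult mult_left_mono)
  qed
  have "lift u (\<lambda>b. k * f b)"
    using u v unfolding lift_def u_def by (auto elim!: eventually_mono intro: tendsto_mult)
  moreover have "AE b in L. \<forall>\<^sub>F i in U. app u i (pt b i) = k * app v i (pt b i)"
  proof (rule AE_eventually)
    have "app u i \<in> borel_measurable (P i)" "app v i \<in> borel_measurable (P i)" for i
      using ifun_app[OF u] ifun_app[OF C] by (auto simp: ifun_def)
    then show "{x\<in>space (P i). app u i x = k * app v i x} \<in> sets (P i)" for i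
      by (intro borel_measurable_eq borel_measurable_times) auto
    show "AE x in P i. app u i x = k * app v i x" for i
      using P_operator_scale[OF A_op bfun_Linf[OF C], of i k]
      by (simp add: app_def u_def[abs_def])
  qed
  then have "AE b in L. ((\<lambda>i. app u i (pt b i)) \<longlongrightarrow> k * Alim f b) U"
    using tendsto_Alim[OF v]
  proof eventually_elim
    case (elim b)
    show ?case
      by (rule Lim_transform_eventually[OF tendsto_mult[OF tendsto_const elim(2)]])
         (use elim(1) in \<open>auto elim: eventually_mono\<close>)
  qed
  ultimately show "AE b in L. Alim (\<lambda>b. k * f b) b = k * Alim f b" by (rule Alim_unique)
next
  show "\<exists>C. \<forall>v\<in>Linf L. \<forall>B. (AE x in L. \<bar>v x\<bar> \<le> B) \<longrightarrow> (\<integral>x. \<bar>Alim v x\<bar> \<partial>L) \<le> C * B"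
    by (intro exI[of _ "2 * c"] ballI allI impI Alim_norm)
qed

text \<open>A lift of a nonnegative function may take negative values, but its positive part is
  again a lift, and the operators preserve positivity on that one.\<close>

lemma positivity_preserving_Alim:
  assumes pos: "\<And>i. positivity_preserving (P i) (A i)"
  shows "positivity_preserving L Alim"
  unfolding positivity_preserving_def
proof (intro ballI impI)
  fix f assume "f \<in> Linf L" and f0: "AE b in L. 0 \<le> f b"
  then obtain v where v: "lift v f" using Linf_lift by metis
  then obtain C where C: "bfun C v" by (auto simp: lift_def)
  define u where "u i x = max 0 (v i x)" for i x
  have u: "bfun C u"
    unfolding u_def
  proof (rule bfunI)
    show "(\<lambda>x. max 0 (v i x)) \<in> borel_measurable (P i)" for i
      using bfunD(1)[OF C] by (intro borel_measurable_max) auto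
    show "\<bar>max 0 (v i x)\<bar> \<le> C" if "x \<in> space (P i)" for i x
      using bfunD(2)[OF C that] by linarith
  qed
  from v have "AE b in L. ((\<lambda>i. v i (pt b i)) \<longlongrightarrow> f b) U" by (simp add: lift_def)
  then have "AE b in L. ((\<lambda>i. u i (pt b i)) \<longlongrightarrow> f b) U"
    using f0
  proof eventually_elim
    case (elim b)
    have "((\<lambda>i. u i (pt b i)) \<longlongrightarrow> max 0 (f b)) U"
      unfolding u_def by (intro tendsto_max tendsto_const elim)
    then show ?case using elim by (simp add: max_def)
  qed
  then have "lift u f" using u by (auto simp: lift_def)
  have "AE b in L. \<forall>\<^sub>F i in U. 0 \<le> app u i (pt b i)"
  proof (rule AE_eventually)
    have "app u i \<in> borel_measurable (P i)" for i using ifun_app[OF u] by (simp add: ifun_def)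
    then show "{x\<in>space (P i). 0 \<le> app u i x} \<in> sets (P i)" for i
      by (intro borel_measurable_le) auto
    show "AE x in P i. 0 \<le> app u i x" for i
      using pos[of i] bfun_Linf[OF u, of i] by (auto simp: positivity_preserving_def app_def u_def)
  qed
  then show "AE b in L. 0 \<le> Alim f b"
    using tendsto_Alim[OF \<open>lift u f\<close>]
  proof eventually_elim
    case (elim b)
    show ?case by (rule tendsto_lowerbound[OF elim(2,1) U_nonbot])
  qed
qed

text \<open>The lift \<open>w\<close> is bounded, so the products inherit bounded
  \<open>q\<close>-th moments from the images and their integrals converge. Self-adjointness then
  follows from uniqueness of limits.\<close>

lemma tendsto_inner:
  assumes v: "lift v f" and w: "lift w g" and f: "f \<in> Linf L" and g: "g \<in> borel_measurable L"
  shows "((\<lambda>i. \<integral>x. A i (v i) x * w i x \<partial>P i) \<longlongrightarrow> (\<integral>b. Alim f b * g b \<partial>L)) U"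
proof -
  obtain C D where "bfun C v" "bfun D w" using v w by (auto simp: lift_def)
  then have C: "bfun (max 0 C) v" "0 \<le> max 0 C" and D: "bfun (max 0 D) w" "0 \<le> max 0 D"
    by (auto intro: bfun_mono)
  define h where "h i x = app v i x * w i x" for i x
  have [measurable]: "app v i \<in> borel_measurable (P i)" "w i \<in> borel_measurable (P i)" for i
    using ifun_app[OF C(1)] D by (auto simp: ifun_def bfun_def)
  have h: "ifun h" unfolding ifun_def h_def by measurable
  then have [measurable]: "h i \<in> borel_measurable (P i)" for i by (simp add: ifun_def)
  let ?D = "(max 0 D) powr q"
  have le: "\<bar>h i x\<bar> powr q \<le> ?D * \<bar>app v i x\<bar> powr q" if "x \<in> space (P i)" for i x
  proof -
    have "\<bar>w i x\<bar> powr q \<le> ?D" using D that q by (intro powr_mono2) (auto simp: bfun_def)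
    then show ?thesis
      unfolding h_def abs_mult powr_mult mult.commute[of "\<bar>app v i x\<bar> powr q"]
      by (rule mult_right_mono) simp
  qed
  have int: "integrable (P i) (\<lambda>x. \<bar>h i x\<bar> powr q)" for i
    by (rule Bochner_Integration.integrable_bound[of _ "\<lambda>x. ?D * \<bar>app v i x\<bar> powr q"])
       (use app_Lq(1)[OF C, of i] le in auto)
  have "(\<integral>x. \<bar>h i x\<bar> powr q \<partial>P i) \<le> ?D * (c * max 0 C) powr q" for i
  proof -
    have "(\<integral>x. \<bar>h i x\<bar> powr q \<partial>P i) \<le> (\<integral>x. ?D * \<bar>app v i x\<bar> powr q \<partial>P i)"
      using int app_Lq(1)[OF C, of i] le by (intro integral_mono) auto
    also have "\<dots> = ?D * (\<integral>x. \<bar>app v i x\<bar> powr q \<partial>P i)" by simp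
    also have "\<dots> \<le> ?D * (c * max 0 C) powr q"
      using app_Lq(2)[OF C, of i] by (rule mult_left_mono) simp
    finally show ?thesis .
  qed
  from integral_tendsto_powr_bounded(1)[OF q h int this]
  have "((\<lambda>i. \<integral>x. h i x \<partial>P i) \<longlongrightarrow> (\<integral>b. std h b \<partial>L)) U" .
  moreover from w have "AE b in L. ((\<lambda>i. w i (pt b i)) \<longlongrightarrow> g b) U" by (simp add: lift_def)
  then have "AE b in L. std h b = Alim f b * g b"
    using tendsto_Alim[OF v]
  proof eventually_elim
    case (elim b)
    then show ?case unfolding h_def by (intro std_eqI tendsto_mult)
  qed
  then have "(\<integral>b. std h b \<partial>L) = (\<integral>b. Alim f b * g b \<partial>L)"
    using measurable_std[OF h] measurable_Alim[OF f] g by (intro integral_cong_AE) auto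
  ultimately show ?thesis by (simp add: h_def app_def)
qed

lemma self_adjoint_Alim:
  assumes sa: "\<And>i. self_adjoint_op (P i) (A i)"
  shows "self_adjoint_op L Alim"
  unfolding self_adjoint_op_def
proof (intro ballI)
  fix f g assume fg: "f \<in> Linf L" "g \<in> Linf L"
  then obtain v w where v: "lift v f" and w: "lift w g" using Linf_lift by metis
  then obtain C D where CD: "bfun C v" "bfun D w" by (auto simp: lift_def)
  have "(\<integral>x. A i (v i) x * w i x \<partial>P i) = (\<integral>x. A i (w i) x * v i x \<partial>P i)" for i
    using sa[of i] bfun_Linf[OF CD(1), of i] bfun_Linf[OF CD(2), of i]
    unfolding self_adjoint_op_def by blast
  then show "(\<integral>x. Alim f x * g x \<partial>L) = (\<integral>x. Alim g x * f x \<partial>L)"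
    using tendsto_inner[OF v w] tendsto_inner[OF w v] fg
    by (intro tendsto_unique[OF U_nonbot]) (auto simp: Linf_def)
qed

lemma graphop_Alim: "(\<And>i. graphop (P i) (A i)) \<Longrightarrow> graphop L Alim"
  by (simp add: graphop_def P_operator_Alim positivity_preserving_Alim self_adjoint_Alim)

end

section \<open>Convergence of profiles\<close>

lemma S_kI:
  assumes "\<And>j. j < k \<Longrightarrow> v j \<in> borel_measurable M" "\<And>j x. j < k \<Longrightarrow> x \<in> space M \<Longrightarrow> v j x \<in> {-1..1}"
  shows "distr M (Rspace (2 * k)) (\<lambda>x. \<lambda>j\<in>{..<2 * k}. if j < k then v j x else A (v (j - k)) x) \<in> S_k M A k"
  using assms unfolding S_k_def by (intro CollectI exI[of _ v]) blast

lemma S_kE: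
  assumes "\<mu> \<in> S_k M A k"
  obtains v where "\<And>j. j < k \<Longrightarrow> v j \<in> borel_measurable M"
    "\<And>j x. j < k \<Longrightarrow> x \<in> space M \<Longrightarrow> v j x \<in> {-1..1}"
    "\<mu> = distr M (Rspace (2 * k)) (\<lambda>x. \<lambda>j\<in>{..<2 * k}. if j < k then v j x else A (v (j - k)) x)"
  using assms unfolding S_k_def by blast

lemma S_k_vector_measurable:
  assumes A: "P_operator M A" and v: "\<And>j. j < k \<Longrightarrow> v j \<in> Linf M"
  shows "(\<lambda>x. \<lambda>j\<in>{..<2 * k}. if j < k then v j x else A (v (j - k)) x) \<in> measurable M (Rspace (2 * k))"
  unfolding Rspace_def
proof (rule measurable_restrict)
  fix j assume j: "j \<in> {..<2 * k}"
  show "(\<lambda>x. if j < k then v j x else A (v (j - k)) x) \<in> borel_measurable M"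
  proof (cases "j < k")
    case True
    then show ?thesis using v[of j] by (simp add: Linf_def)
  next
    case False
    then have "j - k < k" using j by auto
    then show ?thesis using False P_operator_integrable[OF A v] by simp
  qed
qed

lemma unit_ball_Linf:
  assumes "v \<in> borel_measurable M" "\<And>x. x \<in> space M \<Longrightarrow> v x \<in> {-1..1::real}"
  shows "v \<in> Linf M"
  using assms by (auto simp: Linf_def abs_le_iff intro!: exI[of _ 1])

lemma S_k_subset_Rprob:
  assumes "P_operator M A"
  shows "S_k M A k \<subseteq> Rprob (2 * k)"
proof
  fix \<mu> assume "\<mu> \<in> S_k M A k"
  then show "\<mu> \<in> Rprob (2 * k)"
    using assms
    by (elim S_kE) (simp add: distr_in_Rprob P_operator_prob S_k_vector_measurable unit_ball_Linf)
qed

lemma S_k_nonempty: "S_k M A k \<noteq> {}"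
  using S_kI[of k "\<lambda>_ _. 0" M A] by auto

context loeb_op begin

text \<open>Each coordinate of the limiting vector is almost everywhere the standard part of the
  matching coordinate on the graphs, so the convergence of laws of standard parts applies.\<close>

lemma S_k_pair:
  assumes v: "\<And>j. j < k \<Longrightarrow> bfun 1 (v j)" and f: "\<And>j. j < k \<Longrightarrow> f j \<in> Linf L"
    and lift: "\<And>j. j < k \<Longrightarrow> lift (v j) (f j)"
  shows "((\<lambda>i. LP_dist (2 * k)
    (distr (P i) (Rspace (2 * k)) (\<lambda>x. \<lambda>j\<in>{..<2 * k}. if j < k then v j i x else A i (v (j - k) i) x))
    (distr L (Rspace (2 * k)) (\<lambda>b. \<lambda>j\<in>{..<2 * k}. if j < k then f j b else Alim (f (j - k)) b))) \<longlongrightarrow> 0) U"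
proof -
  define g where "g j = (if j < k then v j else app (v (j - k)))" for j
  have g: "ifun (g j)" "AE b in L. fin (g j) b"
    "AE b in L. std (g j) b = (if j < k then f j b else Alim (f (j - k)) b)" if j: "j < 2 * k" for j
  proof -
    consider "j < k" | "\<not> j < k" "j - k < k" using j by linarith
    then have "ifun (g j) \<and> (AE b in L. fin (g j) b) \<and>
      (AE b in L. std (g j) b = (if j < k then f j b else Alim (f (j - k)) b))"
    proof cases
      case 1
      have lim: "AE b in L. ((\<lambda>i. v j i (pt b i)) \<longlongrightarrow> f j b) U" using lift[OF 1] by (simp add: lift_def)
      have "AE b in L. fin (v j) b"
        using AE_space
      proof eventually_elim
        case (elim b)
        then show ?case
          unfolding in_space_L by (intro finI[where C=1]) (auto elim!: eventually_mono intro: bfunD(2)[OF v[OF 1]])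
      qed
      moreover have "AE b in L. std (v j) b = f j b" using lim by eventually_elim (rule std_eqI)
      ultimately show ?thesis using 1 v[OF 1] by (simp add: g_def bfun_def)
    next
      case 2
      then show ?thesis
        using ifun_app[OF v] fin_app[OF v] Alim_eq_std[OF lift] by (simp add: g_def)
    qed
    then show "ifun (g j)" "AE b in L. fin (g j) b"
      "AE b in L. std (g j) b = (if j < k then f j b else Alim (f (j - k)) b)" by blast+
  qed
  have "AE b in L. \<forall>j\<in>{..<2 * k}. std (g j) b = (if j < k then f j b else Alim (f (j - k)) b)"
    using g(3) by (intro AE_finite_allI) auto
  then have "distr L (Rspace (2 * k)) (\<lambda>b. \<lambda>j\<in>{..<2 * k}. std (g j) b) =
    distr L (Rspace (2 * k)) (\<lambda>b. \<lambda>j\<in>{..<2 * k}. if j < k then f j b else Alim (f (j - k)) b)"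
  proof (intro distr_cong_AE refl)
    show "(\<lambda>b. \<lambda>j\<in>{..<2 * k}. std (g j) b) \<in> measurable L (Rspace (2 * k))"
      unfolding Rspace_def by (intro measurable_restrict measurable_std g) simp
    show "(\<lambda>b. \<lambda>j\<in>{..<2 * k}. if j < k then f j b else Alim (f (j - k)) b) \<in> measurable L (Rspace (2 * k))"
      by (rule S_k_vector_measurable[OF P_operator_Alim f])
  qed (auto elim!: eventually_mono)
  moreover have "(\<lambda>x. \<lambda>j\<in>{..<2 * k}. g j i x) =
    (\<lambda>x. \<lambda>j\<in>{..<2 * k}. if j < k then v j i x else A i (v (j - k) i) x)" for i
    by (auto simp: g_def app_def fun_eq_iff)
  ultimately show ?thesis
    using LP_dist_std_tendsto[of "2 * k" g, OF g(1,2)] by simp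
qed

text \<open>Profiles require test functions with values in [-1,1] at every point, which is why lifts
  were clipped everywhere and not only almost everywhere.\<close>

lemma S_k_lift:
  assumes "\<nu> \<in> S_k L Alim k"
  obtains \<mu> where "\<And>i. \<mu> i \<in> S_k (P i) (A i) k" "((\<lambda>i. LP_dist (2 * k) (\<mu> i) \<nu>) \<longlongrightarrow> 0) U"
proof -
  obtain f where f: "\<And>j. j < k \<Longrightarrow> f j \<in> borel_measurable L"
      "\<And>j x. j < k \<Longrightarrow> x \<in> space L \<Longrightarrow> f j x \<in> {-1..1}"
    and \<nu>: "\<nu> = distr L (Rspace (2 * k)) (\<lambda>x. \<lambda>j\<in>{..<2 * k}. if j < k then f j x else Alim (f (j - k)) x)"
    by (rule S_kE[OF assms]) blast
  have "\<exists>v. bfun 1 v \<and> lift v (f j) \<and> (\<forall>i x. \<bar>v i x\<bar> \<le> 1)" if "j < k" for j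
  proof -
    have "AE b in L. \<bar>f j b\<bar> \<le> 1" using f(2)[OF that] by (intro AE_I2) (simp add: abs_le_iff)
    then show ?thesis using lift_exists[OF f(1)[OF that]] by (metis zero_less_one)
  qed
  then obtain v where v: "\<And>j. j < k \<Longrightarrow> bfun 1 (v j)" "\<And>j. j < k \<Longrightarrow> lift (v j) (f j)"
    and v1: "\<And>j i x. j < k \<Longrightarrow> \<bar>v j i x\<bar> \<le> 1"
    by metis
  show ?thesis
  proof
    show "distr (P i) (Rspace (2 * k)) (\<lambda>x. \<lambda>j\<in>{..<2 * k}. if j < k then v j i x else A i (v (j - k) i) x)
      \<in> S_k (P i) (A i) k" for i
      by (rule S_kI[of k "\<lambda>j. v j i"]) (use bfunD(1)[OF v(1)] v1 in \<open>auto simp: abs_le_iff\<close>)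
    show "((\<lambda>i. LP_dist (2 * k)
      (distr (P i) (Rspace (2 * k)) (\<lambda>x. \<lambda>j\<in>{..<2 * k}. if j < k then v j i x else A i (v (j - k) i) x)) \<nu>) \<longlongrightarrow> 0) U"
      unfolding \<nu> by (rule S_k_pair[OF v(1) unit_ball_Linf[OF f] v(2)])
  qed
qed

text \<open>Arbitrary test functions on the graphs lift their own standard parts, which are
  measurable on \<open>L\<close> and again have values in [-1,1].\<close>

lemma S_k_std:
  assumes "\<And>i. \<mu> i \<in> S_k (P i) (A i) k"
  obtains \<nu> where "\<nu> \<in> S_k L Alim k" "((\<lambda>i. LP_dist (2 * k) (\<mu> i) \<nu>) \<longlongrightarrow> 0) U"
proof -
  have "\<forall>i. \<exists>v. (\<forall>j<k. v j \<in> borel_measurable (P i)) \<and> (\<forall>j<k. \<forall>x\<in>space (P i). v j x \<in> {-1..1}) \<and>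
    \<mu> i = distr (P i) (Rspace (2 * k)) (\<lambda>x. \<lambda>j\<in>{..<2 * k}. if j < k then v j x else A i (v (j - k)) x)"
    by (intro allI, rule S_kE[OF assms]) blast
  from choice[OF this] obtain w
    where "\<forall>i. (\<forall>j<k. w i j \<in> borel_measurable (P i)) \<and> (\<forall>j<k. \<forall>x\<in>space (P i). w i j x \<in> {-1..1}) \<and>
      \<mu> i = distr (P i) (Rspace (2 * k)) (\<lambda>x. \<lambda>j\<in>{..<2 * k}. if j < k then w i j x else A i (w i (j - k)) x)"
    by (rule exE)
  then have w: "\<And>i j. j < k \<Longrightarrow> w i j \<in> borel_measurable (P i)"
      "\<And>i j x. j < k \<Longrightarrow> x \<in> space (P i) \<Longrightarrow> w i j x \<in> {-1..1}"
    and \<mu>: "\<And>i. \<mu> i = distr (P i) (Rspace (2 * k)) (\<lambda>x. \<lambda>j\<in>{..<2 * k}. if j < k then w i j x else A i (w i (j - k)) x)"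
    by blast+
  define v where "v j i = w i j" for i j
  have v: "bfun 1 (v j)" if "j < k" for j
    using w that by (intro bfunI) (auto simp: v_def abs_le_iff)
  define f where "f j = std (v j)" for j
  have lim: "((\<lambda>i. v j i (pt b i)) \<longlongrightarrow> f j b) U" if "j < k" "b \<in> space L" for j b
    unfolding f_def using that(2) unfolding in_space_L
    by (intro tendsto_std finI[where C=1]) (auto elim!: eventually_mono intro: bfunD(2)[OF v[OF that(1)]])
  have f: "f j \<in> borel_measurable L" if "j < k" for j
    unfolding f_def using v[OF that] by (intro measurable_std) (simp add: bfun_def)
  have f1: "f j b \<in> {-1..1}" if "j < k" "b \<in> space L" for j b
  proof -
    have "\<forall>\<^sub>F i in U. pt b i \<in> space (P i)" using that(2) by (simp add: in_space_L)
    then have "\<forall>\<^sub>F i in U. \<bar>v j i (pt b i)\<bar> \<le> 1"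
      by eventually_elim (rule bfunD(2)[OF v[OF that(1)]])
    then have "\<bar>f j b\<bar> \<le> 1"
      by (rule tendsto_upperbound[OF tendsto_rabs[OF lim[OF that]] _ U_nonbot])
    then show ?thesis by (simp add: abs_le_iff)
  qed
  have lift: "lift (v j) (f j)" if "j < k" for j
    unfolding lift_def using v[OF that] lim[OF that] by (blast intro: AE_I2)
  show ?thesis
  proof
    show "distr L (Rspace (2 * k)) (\<lambda>x. \<lambda>j\<in>{..<2 * k}. if j < k then f j x else Alim (f (j - k)) x)
      \<in> S_k L Alim k"
      by (rule S_kI[OF f f1])
    show "((\<lambda>i. LP_dist (2 * k) (\<mu> i)
      (distr L (Rspace (2 * k)) (\<lambda>x. \<lambda>j\<in>{..<2 * k}. if j < k then f j x else Alim (f (j - k)) x))) \<longlongrightarrow> 0) U"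
      using S_k_pair[of k v f, OF v unit_ball_Linf[OF f f1] lift] by (simp only: \<mu> v_def)
  qed
qed

text \<open>Convergence along the ultrafilter only gives closeness at some late index; the Cauchy
  property transports it to every late index, so no compactness of the profiles is needed.\<close>
lemma hausdorff_S_k_le:
  assumes cauchy: "\<And>m n. N \<le> m \<Longrightarrow> N \<le> n \<Longrightarrow>
      hausdorff_LP (2 * k) (S_k (P m) (A m) k) (S_k (P n) (A n) k) < e"
    and n: "N \<le> n" and e: "0 < e"
  shows "hausdorff_LP (2 * k) (S_k (P n) (A n) k) (S_k L Alim k) \<le> 2 * e"
proof (rule hausdorff_LP_leI)
  note sub = S_k_subset_Rprob[OF A_op, of _ k] S_k_subset_Rprob[OF P_operator_Alim, of k]
  note close = hausdorff_LP_lessD[OF sub(1) sub(1) S_k_nonempty cauchy]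
  show "S_k (P n) (A n) k \<subseteq> Rprob (2 * k)" "S_k L Alim k \<subseteq> Rprob (2 * k)" by (rule sub)+
  show "S_k (P n) (A n) k \<noteq> {}" "S_k L Alim k \<noteq> {}" by (rule S_k_nonempty)+
  have late: "\<exists>m\<ge>N. LP_dist (2 * k) (\<mu>' m) \<nu> < e"
    if "((\<lambda>i. LP_dist (2 * k) (\<mu>' i) \<nu>) \<longlongrightarrow> 0) U" for \<mu>' \<nu>
  proof -
    have "\<forall>\<^sub>F m in U. LP_dist (2 * k) (\<mu>' m) \<nu> < e" using that e by (rule order_tendstoD)
    moreover have "\<forall>\<^sub>F m in U. N \<le> m" by (rule U_seq) (rule eventually_ge_at_top)
    ultimately have "\<forall>\<^sub>F m in U. N \<le> m \<and> LP_dist (2 * k) (\<mu>' m) \<nu> < e" by eventually_elim simp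
    then show ?thesis using eventually_happens'[OF U_nonbot] by blast
  qed
  {
    fix \<mu> assume \<mu>: "\<mu> \<in> S_k (P n) (A n) k"
    \<comment> \<open>\<open>S_k_std\<close> needs a law at every index; below \<open>N\<close> an
      arbitrary member of the profile fills the gap.\<close>
    have "\<exists>\<mu>'. \<mu>' \<in> S_k (P m) (A m) k \<and> (N \<le> m \<longrightarrow> LP_dist (2 * k) \<mu> \<mu>' < e)" for m
    proof (cases "N \<le> m")
      case True
      then show ?thesis using close[OF n True \<mu>] by metis
    next
      case False
      then show ?thesis using S_k_nonempty by blast
    qed
    then obtain \<mu>' where \<mu>': "\<And>m. \<mu>' m \<in> S_k (P m) (A m) k"
      "\<And>m. N \<le> m \<Longrightarrow> LP_dist (2 * k) \<mu> (\<mu>' m) < e" by metis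
    obtain \<nu> where \<nu>: "\<nu> \<in> S_k L Alim k" "((\<lambda>i. LP_dist (2 * k) (\<mu>' i) \<nu>) \<longlongrightarrow> 0) U"
      by (rule S_k_std[OF \<mu>'(1)])
    obtain m where m: "N \<le> m" "LP_dist (2 * k) (\<mu>' m) \<nu> < e" using late[OF \<nu>(2)] by blast
    have "LP_dist (2 * k) \<mu> \<nu> \<le> LP_dist (2 * k) \<mu> (\<mu>' m) + LP_dist (2 * k) (\<mu>' m) \<nu>"
      using \<mu> \<mu>'(1)[of m] \<nu>(1) sub by (intro LP_dist_triangle) blast+
    then show "\<exists>\<nu>\<in>S_k L Alim k. LP_dist (2 * k) \<mu> \<nu> \<le> 2 * e"
      using \<mu>'(2)[OF m(1)] m(2) \<nu>(1) by (intro bexI[of _ \<nu>]) auto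
  next
    fix \<nu> assume \<nu>: "\<nu> \<in> S_k L Alim k"
    then obtain \<mu>' where \<mu>': "\<And>i. \<mu>' i \<in> S_k (P i) (A i) k" "((\<lambda>i. LP_dist (2 * k) (\<mu>' i) \<nu>) \<longlongrightarrow> 0) U"
      by (rule S_k_lift) blast
    obtain m where m: "N \<le> m" "LP_dist (2 * k) (\<mu>' m) \<nu> < e" using late[OF \<mu>'(2)] by blast
    obtain \<mu> where \<mu>: "\<mu> \<in> S_k (P n) (A n) k" "LP_dist (2 * k) (\<mu>' m) \<mu> < e"
      by (rule close[OF m(1) n \<mu>'(1)])
    have "LP_dist (2 * k) \<mu> \<nu> \<le> LP_dist (2 * k) \<mu> (\<mu>' m) + LP_dist (2 * k) (\<mu>' m) \<nu>"
      using \<mu> \<mu>'(1)[of m] \<nu> sub by (intro LP_dist_triangle) blast+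
    then show "\<exists>\<mu>\<in>S_k (P n) (A n) k. LP_dist (2 * k) \<mu> \<nu> \<le> 2 * e"
      using \<mu> m(2) LP_dist_commute[of "2 * k" \<mu> "\<mu>' m"] by (intro bexI[of _ \<mu>]) auto
  }
qed

text \<open>Each summand tends to 0, and all Hausdorff distances are at most 1, so the geometric
  weights dominate the series and limit and sum may be exchanged by Tannery's theorem.\<close>

lemma d_M_tendsto_Alim:
  assumes conv: "action_convergent P A"
  shows "(\<lambda>i. d_M (P i) (A i) L Alim) \<longlonglongrightarrow> 0"
proof -
  let ?h = "\<lambda>k i. hausdorff_LP (2 * Suc k) (S_k (P i) (A i) (Suc k)) (S_k L Alim (Suc k))"
  have h01: "0 \<le> ?h k i" "?h k i \<le> 1" for k i
    using S_k_subset_Rprob[OF A_op] S_k_subset_Rprob[OF P_operator_Alim] S_k_nonempty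
    by (intro hausdorff_LP_nonneg hausdorff_LP_le_1; blast)+
  have "(\<lambda>i. ?h k i) \<longlonglongrightarrow> 0" for k
  proof (rule LIMSEQ_I)
    fix r :: real assume "0 < r"
    then have "0 < r / 3" by simp
    then obtain N where N: "\<And>m n. N \<le> m \<Longrightarrow> N \<le> n \<Longrightarrow>
        hausdorff_LP (2 * Suc k) (S_k (P m) (A m) (Suc k)) (S_k (P n) (A n) (Suc k)) < r / 3"
      using conv[unfolded action_convergent_def, THEN conjunct2, rule_format, of "Suc k" "r / 3"] by auto
    have "norm (?h k n - 0) < r" if "N \<le> n" for n
      using hausdorff_S_k_le[OF N that \<open>0 < r / 3\<close>] h01[of k n] \<open>0 < r\<close> by simp
    then show "\<exists>N. \<forall>n\<ge>N. norm (?h k n - 0) < r" by blast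
  qed
  then have lim: "(\<lambda>i. (1/2) ^ Suc k * ?h k i) \<longlonglongrightarrow> 0" for k
    by (rule tendsto_mult_right_zero)
  have "(\<lambda>i. \<Sum>k. (1/2) ^ Suc k * ?h k i) \<longlonglongrightarrow> (\<Sum>k. 0 :: real)"
  proof (rule tannerys_theorem[THEN conjunct2, THEN conjunct2, OF lim])
    have "norm ((1/2) ^ Suc k * ?h k i) \<le> (1/2) ^ Suc k" for k i
      using h01[of k i] by (simp add: abs_mult mult_left_le)
    then show "\<forall>\<^sub>F (k, i) in sequentially \<times>\<^sub>F sequentially.
        norm ((1/2) ^ Suc k * ?h k i) \<le> (1/2 :: real) ^ Suc k"
      by (intro always_eventually) auto
    show "summable (\<lambda>k. (1/2 :: real) ^ Suc k)"
      by (subst summable_Suc_iff) (rule summable_geometric, simp)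
  qed simp
  then show ?thesis by (simp add: d_M_def)
qed

end

section \<open>Limits of action convergent sequences and the case of graphs\<close>

text \<open>Graphs enter only through the conditional graphop claim. The type of the limit space is
  any type that surjects onto the sequences of points.\<close>

theorem action_convergent_limit:
  fixes P :: "nat \<Rightarrow> 'a measure" and h :: "'b \<Rightarrow> nat \<Rightarrow> 'a"
  assumes h: "surj h" and conv: "action_convergent P A"
    and p: "1 \<le> p" and q: "1 < q" and c: "0 < c"
    and bound: "\<And>i. pq_norm (P i) p q (A i) \<le> ennreal c"
  obtains M :: "'b measure" and B where "P_operator M B"
    "(\<And>i. graphop (P i) (A i)) \<Longrightarrow> graphop M B"
    "(\<lambda>i. d_M (P i) (A i) M B) \<longlonglongrightarrow> 0"
proof -
  obtain U :: "nat filter" where U: "U \<le> sequentially" "U \<noteq> bot"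
    "\<And>Q. eventually Q U \<or> eventually (\<lambda>i. \<not> Q i) U"
    by (rule ultrafilter_extension[OF sequentially_bot]) blast
  have op: "P_operator (P i) (A i)" for i using conv by (simp add: action_convergent_def)
  interpret loeb_op U P h A p q c
    by (intro loeb_op.intro loeb.intro ultra.intro loeb_axioms.intro loeb_op_axioms.intro
        U h p q c bound op P_operator_prob[OF op])
  show ?thesis
    by (rule that[OF P_operator_Alim graphop_Alim d_M_tendsto_Alim[OF conv]])
qed

text \<open>Self-adjointness is a double count over ordered edges: exchange the sums and use
  symmetry of the edge relation. Positivity uses the sign of the normalisation
  \<open>d\<close>.\<close>

lemma graph_operator_graphop:
  fixes G :: "nat \<times> (nat \<times> nat) set" and d :: real
  assumes G: "finite_graph G" and d: "0 < d"
    and op: "P_operator (graph_measure G) (\<lambda>v x. graph_operator G v x / d)"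
  shows "graphop (graph_measure G) (\<lambda>v x. graph_operator G v x / d)"
  unfolding graphop_def
proof (intro conjI op)
  let ?n = "fst G"
  have sum_eq: "graph_operator G v x = (\<Sum>j<?n. if (j, x) \<in> snd G then v j else 0)" for v x
    unfolding graph_operator_def by (rule sum.mono_neutral_cong_left) auto
  have sym: "(a, b) \<in> snd G \<longleftrightarrow> (b, a) \<in> snd G" for a b
    using G by (auto simp: finite_graph_def dest: symD)
  show "self_adjoint_op (graph_measure G) (\<lambda>v x. graph_operator G v x / d)"
    unfolding self_adjoint_op_def
  proof (intro ballI)
    fix v w :: "nat \<Rightarrow> real"
    have "(\<Sum>x<?n. graph_operator G v x / d * w x) = (\<Sum>x<?n. \<Sum>j<?n. (if (j, x) \<in> snd G then v j * w x / d else 0))"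
      by (auto simp: sum_eq sum_distrib_right sum_divide_distrib intro!: sum.cong)
    also have "\<dots> = (\<Sum>j<?n. \<Sum>x<?n. (if (j, x) \<in> snd G then v j * w x / d else 0))" by (rule sum.swap)
    also have "\<dots> = (\<Sum>x<?n. graph_operator G w x / d * v x)"
      using sym by (auto simp: sum_eq sum_distrib_right sum_divide_distrib intro!: sum.cong)
    finally show "(\<integral>x. graph_operator G v x / d * w x \<partial>graph_measure G) =
        (\<integral>x. graph_operator G w x / d * v x \<partial>graph_measure G)"
      by (simp only: graph_measure_def integral_uniform_count_measure finite_lessThan)
  qed
  \<comment> \<open>Every vertex has positive mass, so almost everywhere means everywhere on the
    vertex set.\<close>
  have AE_iff: "(AE x in graph_measure G. Q x) \<longleftrightarrow> (\<forall>x<?n. Q x)" for Q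
    using G unfolding graph_measure_def uniform_count_measure_def AE_point_measure
    by (auto simp: finite_graph_def)
  show "positivity_preserving (graph_measure G) (\<lambda>v x. graph_operator G v x / d)"
    unfolding positivity_preserving_def AE_iff using d
    by (auto simp: sum_eq intro!: divide_nonneg_pos sum_nonneg)
qed

theorem theorem5p2:
  fixes f :: "nat \<times> (nat \<times> nat) set \<Rightarrow> real"
    and G :: "nat \<Rightarrow> nat \<times> (nat \<times> nat) set"
    and p q c :: real
  assumes f_pos: "\<forall>H. finite_graph H \<longrightarrow> f H > 0"
    and f_iso: "\<forall>H H'. finite_graph H \<and> finite_graph H' \<and> graph_iso H H' \<longrightarrow> f H = f H'"
    and G_graph: "\<forall>i. finite_graph (G i)"
    and conv: "action_convergent (\<lambda>i. graph_measure (G i))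
                 (\<lambda>i v x. graph_operator (G i) v x / f (G i))"
    and p: "1 \<le> p" and q: "1 < q" and c: "c > 0"
    and bound: "\<forall>i. pq_norm (graph_measure (G i)) p q
                      (\<lambda>v x. graph_operator (G i) v x / f (G i)) \<le> ennreal c"
  shows "\<exists>(M :: real measure) A. graphop M A \<and>
           (\<lambda>i. d_M (graph_measure (G i)) (\<lambda>v x. graph_operator (G i) v x / f (G i)) M A)
             \<longlonglongrightarrow> 0"
proof -
  obtain h :: "real \<Rightarrow> nat \<Rightarrow> nat" where h: "surj h" using surj_real_sequences by blast
  have graphop: "graphop (graph_measure (G i)) (\<lambda>v x. graph_operator (G i) v x / f (G i))" for i
  proof (rule graph_operator_graphop)
    show "finite_graph (G i)" using G_graph by blast
    then show "0 < f (G i)" using f_pos by blast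
    show "P_operator (graph_measure (G i)) (\<lambda>v x. graph_operator (G i) v x / f (G i))"
      using conv by (simp add: action_convergent_def)
  qed
  show ?thesis
    by (rule action_convergent_limit[OF h conv p q c bound[rule_format]]) (use graphop in blast)
qed

end
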